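(* Let $P(z,w)=\sum_{n,m\ge0}P_{n,m}z^nw^m$ be the unique formal power series satisfying $$P=1+wzP^2+wz^4P^4+wz^7P^6+\cdots=1+\frac{wzP^2}{1-z^3P^2}.$$ Then the bivariate quiddity generating function $Q(z,w)=\sum_{n,m\ge0}Q_{n,m}z^nw^m$ satisfies $$Q(z,w)=1+wzP^2+wz^4P^5+wz^7P^8+\cdots=1+\frac{wzP^2}{1-z^3P^3}.$$
   Context: For $n\ge1$, fix a convex $(n+2)$-gon with vertices labelled $0,\dots,n+1$ in cyclic order. A dissection is a set of pairwise non-crossing diagonals (chords); these partition the polygon into sub-polygons (cells). The quiddity of a dissection is the tuple $(a_0,\dots,a_{n+1})$, $a_i$ being the number of cells having vertex $i$. A dissection is 3-periodic if every cell has a number of vertices divisible by $3$. For $n\ge1$, $Q_{n,m}$ is the number of distinct tuples occurring as quiddities of 3-periodic dissections of the $(n+2)$-gon into exactly $m$ cells; by convention $Q_{0,0}=1$ and $Q_{0,m}=0$ for $m>0$. *)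

theory Defs
  imports "HOL-Computational_Algebra.Formal_Power_Series"
begin

text \<open>
  A polygon is identified with its set of vertices: for \<open>n \<ge> 1\<close> the vertices of the convex
  \<open>(n+2)\<close>-gon are \<open>0, \<dots>, n+1\<close> in cyclic order, and a sub-polygon is given by a subset
  \<open>C\<close> of at least three of them, with the induced cyclic order. Chords are two-element sets.
\<close>

definition polygon :: "nat \<Rightarrow> nat set" where
  "polygon n = {0..n+1}"

text \<open>
  Two vertices \<open>i < j\<close> of \<open>C\<close> are neighbours if no vertex of \<open>C\<close> lies strictly between them,
  or if they are the first and the last vertex of \<open>C\<close>.
\<close>

definition sides :: "nat set \<Rightarrow> nat set set" where
  "sides C = {{i, j} |i j. i \<in> C \<and> j \<in> C \<and> i < j \<and>
                (C \<inter> {i<..<j} = {} \<or> C \<subseteq> {i..j})}"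

definition diagonals :: "nat set \<Rightarrow> nat set set" where
  "diagonals C = {{i, j} |i j. i \<in> C \<and> j \<in> C \<and> i < j} - sides C"

definition crossing :: "nat set \<Rightarrow> nat set \<Rightarrow> bool" where
  "crossing d e \<longleftrightarrow> (\<exists>i j k l. i < k \<and> k < j \<and> j < l \<and>
      ((d = {i, j} \<and> e = {k, l}) \<or> (e = {i, j} \<and> d = {k, l})))"

definition dissection :: "nat \<Rightarrow> nat set set \<Rightarrow> bool" where
  "dissection n D \<longleftrightarrow> D \<subseteq> diagonals (polygon n) \<and> (\<forall>d\<in>D. \<forall>e\<in>D. \<not> crossing d e)"

text \<open>
  The cells are the sub-polygons bounded by sides of the polygon and chords of the dissection
  which are not cut further. A chord cutting through such a sub-polygon without crossing its
  boundary must be one of its diagonals, so it is enough to exclude those.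
\<close>

definition cells :: "nat \<Rightarrow> nat set set \<Rightarrow> nat set set" where
  "cells n D = {C. C \<subseteq> polygon n \<and> card C \<ge> 3 \<and>
                   sides C \<subseteq> sides (polygon n) \<union> D \<and> diagonals C \<inter> D = {}}"

definition quiddity :: "nat \<Rightarrow> nat set set \<Rightarrow> nat list" where
  "quiddity n D = map (\<lambda>i. card {C \<in> cells n D. i \<in> C}) [0..<n+2]"

definition three_periodic :: "nat \<Rightarrow> nat set set \<Rightarrow> bool" where
  "three_periodic n D \<longleftrightarrow> (\<forall>C\<in>cells n D. 3 dvd card C)"

definition quiddity_count :: "nat \<Rightarrow> nat \<Rightarrow> nat" where
  "quiddity_count n m =
     (if n = 0 then (if m = 0 then 1 else 0)
      else card {quiddity n D |D. dissection n D \<and> three_periodic n D \<and> card (cells n D) = m})"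

text \<open>
  Bivariate power series in \<open>z\<close> and \<open>w\<close> are power series in \<open>z\<close> whose coefficients are power
  series in \<open>w\<close>.
\<close>

abbreviation Z :: "rat fps fps" where
  "Z \<equiv> fps_X"

abbreviation W :: "rat fps fps" where
  "W \<equiv> fps_const fps_X"

definition quiddity_gf :: "rat fps fps" where
  "quiddity_gf = Abs_fps (\<lambda>n. Abs_fps (\<lambda>m. of_nat (quiddity_count n m)))"

end

theory Submission
  imports Defs
begin

text \<open>
  Write a tuple of positive integers \<open>(a\<^sub>0, \<dots>, a\<^sub>k)\<close> as the word \<open>U(SU)^(a\<^sub>0 - 1) \<dots> U(SU)^(a\<^sub>k - 1)\<close>.
  A single cell with \<open>3k + 3\<close> vertices becomes \<open>U^(3k + 3)\<close>, and gluing such a cell along a side inserts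
  \<open>S U^(3k + 3) S\<close> between two adjacent letters \<open>U\<close>. Every dissection arises by such gluings, so the
  quiddities of 3-periodic dissections correspond to words that are trivial in the free product
  \<open>\<langle>S, U | S\<^sup>2 = U\<^sup>3 = 1\<rangle>\<close>, and conversely every trivial word that begins and ends with \<open>U\<close> and does not
  contain \<open>SS\<close> is one of them. Reducing a trivial word from left to right is an unambiguous parse: in a cell
  opened by a letter \<open>S\<close>, no letter \<open>S\<close> can open a further cell after every third \<open>U\<close>, since it would cancel
  the opening one; this leaves \<open>2k + 2\<close> of the \<open>3k + 2\<close> gaps, whereas all of them are free in the root cell.
  The resulting unambiguous grammar translates into the two functional equations.
\<close>

section \<open>Trivial words in the modular group\<close>

datatype letter = U | S

text \<open>
  Words trivial in the free product, with no two adjacent \<open>S\<close>, parsed deterministically: \<open>gap_word\<close> is what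
  can fill a gap between two consecutive letters \<open>U\<close> of one cell, \<open>cell_word\<close> is the part of a cell between
  the letters \<open>S\<close> separating it from its parent. No gap follows every third \<open>U\<close> of a \<open>cell_word\<close>, because an
  \<open>S\<close> there would already cancel the one opening the cell; the root cell (\<open>root_word\<close>) has no such letter,
  so all its gaps are available.
\<close>

inductive gap_word :: "letter list \<Rightarrow> bool" and cell_word :: "letter list \<Rightarrow> bool" where
  gap_word_Nil: "gap_word []"
| gap_word_wrap: "cell_word a \<Longrightarrow> gap_word (S # a @ [S])"
| cell_word_single: "gap_word p \<Longrightarrow> gap_word q \<Longrightarrow> cell_word (U # p @ U # q @ [U])"
| cell_word_append: "gap_word p \<Longrightarrow> gap_word q \<Longrightarrow> cell_word a \<Longrightarrow> cell_word (U # p @ U # q @ U # a)"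

inductive root_word :: "letter list \<Rightarrow> bool" where
  root_word_single: "gap_word p \<Longrightarrow> gap_word q \<Longrightarrow> root_word (U # p @ U # q @ [U])"
| root_word_append: "gap_word p \<Longrightarrow> gap_word q \<Longrightarrow> gap_word r \<Longrightarrow> root_word a \<Longrightarrow> root_word (U # p @ U # q @ U # r @ a)"

section \<open>Unambiguity of the grammar\<close>

lemma gap_word_start: "gap_word p \<Longrightarrow> p = [] \<or> (\<exists>a. cell_word a \<and> p = S # a @ [S])"
  by (cases rule: gap_word.cases) auto

lemma cell_word_start: "cell_word a \<Longrightarrow> \<exists>b. a = U # b"
  by (cases rule: cell_word.cases) auto

lemma root_word_start: "root_word a \<Longrightarrow> \<exists>b. a = U # b"
  by (cases rule: root_word.cases) auto

text \<open>Both rules for \<open>cell_word\<close> agree up to the third \<open>U\<close>; this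
  form treats them together, leaving open whether the cell ends there.\<close>

lemma cell_word_cases_rest:
  assumes "cell_word a"
  obtains p q r where "gap_word p" "gap_word q" "a = U # p @ U # q @ U # r" "r = [] \<or> cell_word r"
  using assms by (cases rule: cell_word.cases) auto

text \<open>One letter of lookahead decides the parse: a gap is empty iff the next letter is
  \<open>U\<close>, and after a third \<open>U\<close> the cell goes on iff the next letter is
  \<open>U\<close>. The terminators \<open>U\<close> and \<open>S\<close> in the statements provide
  this letter.\<close>

lemma
  gap_word_prefix_unique: "gap_word p \<Longrightarrow> gap_word p' \<Longrightarrow> p @ U # x = p' @ U # y \<Longrightarrow> p = p'" and
  cell_word_prefix_unique: "cell_word a \<Longrightarrow> cell_word a' \<Longrightarrow> a @ S # x = a' @ S # y \<Longrightarrow> a = a'"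
proof (induction arbitrary: p' x y and a' x y rule: gap_word_cell_word.inducts)
  case gap_word_Nil
  then show ?case using gap_word_start[OF gap_word_Nil(1)] by auto
next
  case (gap_word_wrap a)
  from gap_word_start[OF gap_word_wrap(3)] show ?case
  proof
    assume "p' = []"
    with gap_word_wrap(4) show ?thesis by simp
  next
    assume "\<exists>a. cell_word a \<and> p' = S # a @ [S]"
    then obtain a' where a': "cell_word a'" "p' = S # a' @ [S]" by blast
    have "a @ S # (U # x) = a' @ S # (U # y)" using gap_word_wrap(4) a' by simp
    from gap_word_wrap(2)[OF a'(1) this] a' show ?thesis by simp
  qed
next
  case (cell_word_single p q)
  from cell_word_single(5) obtain p' q' r where a': "gap_word p'" "gap_word q'" "a' = U # p' @ U # q' @ U # r" "r = [] \<or> cell_word r"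
    by (rule cell_word_cases_rest)
  have p: "p @ U # (q @ U # S # x) = p' @ U # (q' @ U # r @ S # y)"
    using cell_word_single(6) a' by simp
  note pp = cell_word_single(3)[OF a'(1) p]
  have q: "q @ U # (S # x) = q' @ U # (r @ S # y)" using p pp by simp
  note qq = cell_word_single(4)[OF a'(2) q]
  have "S # x = r @ S # y" using q qq by simp
  \<comment> \<open>The left side begins with \<open>S\<close>, whereas a nonempty \<open>r\<close>
    would be a \<open>cell_word\<close> and begin with \<open>U\<close>.\<close>
  then have "r = []" using a'(4) cell_word_start by fastforce
  then show ?case using pp qq a' by simp
next
  case (cell_word_append p q a)
  from cell_word_append(7) obtain p' q' r where a': "gap_word p'" "gap_word q'" "a' = U # p' @ U # q' @ U # r" "r = [] \<or> cell_word r"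
    by (rule cell_word_cases_rest)
  have p: "p @ U # (q @ U # a @ S # x) = p' @ U # (q' @ U # r @ S # y)"
    using cell_word_append(8) a' by simp
  note pp = cell_word_append(4)[OF a'(1) p]
  have q: "q @ U # (a @ S # x) = q' @ U # (r @ S # y)" using p pp by simp
  note qq = cell_word_append(5)[OF a'(2) q]
  have r: "a @ S # x = r @ S # y" using q qq by simp
  then have "cell_word r" using a'(4) cell_word_start[OF cell_word_append(3)] by auto
  from cell_word_append(6)[OF this r] show ?case using pp qq a' by simp
qed

text \<open>In \<open>PSL(2, Z)\<close>, with \<open>T = US\<close>, the entry \<open>a\<close> contributes \<open>T^a S\<close>. Truncated subtraction identifies \<open>0\<close> with \<open>1\<close>.\<close>

fun word_of :: "nat list \<Rightarrow> letter list" where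
  "word_of [] = []"
| "word_of (a # as) = U # concat (replicate (a - 1) [S, U]) @ word_of as"

text \<open>Each of the \<open>3 * k + 1\<close> new vertices lies in the new cell only. Ears are
  glued only to sides joining list neighbours, never to the side between the last and the first
  vertex; cutting along a shortest chord shows that this suffices.\<close>

inductive ear_quiddity :: "nat \<Rightarrow> nat list \<Rightarrow> bool" where
  ear_quiddity_cell: "ear_quiddity 1 (replicate (3 * k + 3) 1)"
| ear_quiddity_ear: "ear_quiddity m (xs @ [a, b] @ ys) \<Longrightarrow>
    ear_quiddity (Suc m) (xs @ [Suc a] @ replicate (3 * k + 1) 1 @ [Suc b] @ ys)"

text \<open>The entry sum counts incidences of vertices and cells. An ear adds
  \<open>3 * k + 3\<close> to it, \<open>3 * k + 1\<close> to the length and 1 to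
  \<open>m\<close>.\<close>

lemma ear_quiddity_props:
  "ear_quiddity m a \<Longrightarrow> sum_list a + 2 = length a + 2 * m \<and> m > 0 \<and> length a \<ge> 3 \<and> 0 \<notin> set a"
  by (induction rule: ear_quiddity.induct) (auto simp: sum_list_replicate)

lemma word_of_append [simp]: "word_of (xs @ ys) = word_of xs @ word_of ys"
  by (induction xs) auto

lemma word_of_ones [simp]: "word_of (replicate k 1) = replicate k U"
  by (induction k) auto

text \<open>An ear raises the entries on both of its ends; reading one increment at the right end of
  its entry and the other at the left end puts the two new letters \<open>S\<close> around the
  ear.\<close>

lemma word_of_Suc:
  assumes "a > 0"
  shows "word_of [Suc a] = word_of [a] @ [S, U]" "word_of [Suc a] = [U, S] @ word_of [a]"
proof -
  have "concat (replicate (Suc k) [S, U]) = concat (replicate k [S, U]) @ [S, U]" for k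
    by (induction k) auto
  then show "word_of [Suc a] = word_of [a] @ [S, U]" using assms by (cases a) auto
  show "word_of [Suc a] = [U, S] @ word_of [a]" using assms by (cases a) auto
qed

lemma count_word_of:
  "0 \<notin> set a \<Longrightarrow> count_list (word_of a) U = sum_list a"
  "0 \<notin> set a \<Longrightarrow> count_list (word_of a) S + length a = sum_list a"
proof -
  have "count_list (concat (replicate k [S, U])) U = k" 
    "count_list (concat (replicate k [S, U])) S = k" for k
    by (induction k) auto
  then show "0 \<notin> set a \<Longrightarrow> count_list (word_of a) U = sum_list a"
    "0 \<notin> set a \<Longrightarrow> count_list (word_of a) S + length a = sum_list a"
    by (induction a) auto
qed

lemma SU_inj:
  assumes "concat (replicate k [S, U]) @ x = concat (replicate l [S, U]) @ y"
    and "x = [] \<or> (\<exists>u. x = U # u)" "y = [] \<or> (\<exists>u. y = U # u)"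
  shows "k = l"
  using assms by (induction k arbitrary: l) (case_tac l; auto)+

lemma word_of_hd: "word_of a = [] \<or> (\<exists>u. word_of a = U # u)"
  by (cases a) auto

text \<open>Every entry opens with a \<open>U\<close> that is not preceded by \<open>S\<close>, so
  the entry boundaries can be recovered. Zeros are excluded because they would be confused with
  ones.\<close>

lemma inj_word_of: "0 \<notin> set a \<Longrightarrow> 0 \<notin> set b \<Longrightarrow> word_of a = word_of b \<Longrightarrow> a = b"
proof (induction a arbitrary: b)
  case Nil
  then show ?case by (cases b) auto
next
  case (Cons x a)
  then obtain y c where b: "b = y # c" by (cases b) auto
  have e: "concat (replicate (x - 1) [S, U]) @ word_of a = concat (replicate (y - 1) [S, U]) @ word_of c"
    using Cons.prems b by simp
  from SU_inj[OF this word_of_hd word_of_hd] have "x - 1 = y - 1" .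
  then have "x = y" using Cons.prems b by auto
  moreover from this e Cons b have "a = c" by simp
  ultimately show ?case using b by simp
qed

text \<open>Inside one entry any two letters \<open>U\<close> are separated by \<open>S\<close>, so
  a factor \<open>UU\<close> marks the border of two neighbouring entries, that is, a side to which
  an ear can be glued.\<close>

lemma word_of_split:
  assumes "0 \<notin> set a" "word_of a = x @ U # U # y"
  obtains xs b c ys where "a = xs @ [b, c] @ ys" "word_of (xs @ [b]) = x @ [U]" "word_of (c # ys) = U # y"
proof -
  \<comment> \<open>Either the whole block precedes the pair \<open>UU\<close>, or the first
    \<open>U\<close> of the pair is the last letter of the block.\<close>
  have SU: "\<exists>z. x = concat (replicate k [S, U]) @ z \<and> v = z @ U # U # y \<or>
     k > 0 \<and> x @ [U] = concat (replicate k [S, U]) \<and> v = U # y"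
    if "concat (replicate k [S, U]) @ v = x @ U # U # y" for k v x
    using that 
  proof (induction k arbitrary: x)
    case (Suc k)
    then obtain x' where x: "x = S # x'" by (cases x) auto
    show ?case
    proof (cases x')
      case Nil
      with Suc.prems x have "concat (replicate k [S, U]) @ v = U # y" by simp
      then have "k = 0" by (cases k) auto
      with Suc.prems x Nil show ?thesis by auto
    next
      case (Cons l x'')
      with Suc.prems x have "l = U" "concat (replicate k [S, U]) @ v = x'' @ U # U # y" by auto
      with Suc.IH[OF this(2)] x Cons show ?thesis by auto
    qed
  qed simp
  have "\<exists>xs b c ys. a = xs @ [b, c] @ ys \<and> word_of (xs @ [b]) = x @ [U] \<and> word_of (c # ys) = U # y"
    using assms
  proof (induction a arbitrary: x)
    case (Cons e a)
    have step: ?case if x: "x @ [U] = U # concat (replicate (e - 1) [S, U])" "word_of a = U # y"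
    proof -
      obtain c ys where "a = c # ys" using x by (cases a) auto
      then show ?thesis using x by (intro exI[of _ "[]"] exI[of _ e] exI[of _ c] exI[of _ ys]) simp
    qed
    show ?case
    proof (cases x)
      case Nil
      then have 1: "concat (replicate (e - 1) [S, U]) @ word_of a = U # y" using Cons.prems by simp
      then have "e - 1 = 0" by (cases "e - 1") auto
      with 1 Nil step show ?thesis by simp
    next
      case (Cons l x')
      with Cons.prems have l: "l = U" "concat (replicate (e - 1) [S, U]) @ word_of a = x' @ U # U # y" by auto
      from SU[OF l(2)] show ?thesis
      proof (elim exE disjE conjE)
        fix z assume z: "x' = concat (replicate (e - 1) [S, U]) @ z" "word_of a = z @ U # U # y"
        obtain xs b c ys where "a = xs @ [b, c] @ ys" "word_of (xs @ [b]) = z @ [U]" "word_of (c # ys) = U # y"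
          using Cons.IH[OF _ z(2)] Cons.prems by auto
        then show ?thesis using l Cons z
          by (intro exI[of _ "e # xs"] exI[of _ b] exI[of _ c] exI[of _ ys]) simp
      next
        assume "x' @ [U] = concat (replicate (e - 1) [S, U])" "word_of a = U # y"
        then show ?thesis using l Cons step by simp
      qed
    qed
  qed simp
  then show ?thesis using that by blast
qed

section \<open>Words of the grammar are words of quiddities\<close>

definition quiddity_word :: "letter list \<Rightarrow> bool" where
  "quiddity_word w \<longleftrightarrow> (\<exists>m a. ear_quiddity m a \<and> w = word_of a)"

lemma quiddity_word_ear:
  assumes "quiddity_word (x @ U # U # y)"
  shows "quiddity_word (x @ U # S # replicate (3 * k + 3) U @ S # U # y)"
proof -
  from assms obtain m a where a: "ear_quiddity m a" "word_of a = x @ U # U # y"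
    unfolding quiddity_word_def by metis
  have nz: "0 \<notin> set a" using ear_quiddity_props[OF a(1)] by simp
  from word_of_split[OF nz a(2)] obtain xs b c ys
    where s: "a = xs @ [b, c] @ ys" "word_of (xs @ [b]) = x @ [U]" "word_of (c # ys) = U # y" .
  have "word_of (xs @ [Suc b] @ replicate (3 * k + 1) 1 @ [Suc c] @ ys)
     = word_of (xs @ [b]) @ [S, U] @ replicate (3 * k + 1) U @ [U, S] @ word_of (c # ys)"
  proof -
    have "word_of [Suc b] = word_of [b] @ [S, U]" "word_of [Suc c] = [U, S] @ word_of [c]"
      using nz s(1) by (intro word_of_Suc; force)+
    moreover have "word_of (c # ys) = word_of [c] @ word_of ys" by simp
    ultimately show ?thesis
      by (simp only: word_of_append word_of_ones append_assoc)
  qed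
  \<comment> \<open>Each increment contributes one \<open>U\<close>, which turns the
    \<open>3 * k + 1\<close> new vertices into \<open>3 * k + 3\<close> letters.\<close>
  also have "\<dots> = x @ U # S # replicate (3 * k + 3) U @ S # U # y"
    using s by (simp add: numeral_3_eq_3 replicate_app_Cons_same)
  finally show ?thesis
    using ear_quiddity_ear[OF a(1)[unfolded s(1)], of k] unfolding quiddity_word_def by metis
qed

text \<open>A cell is first glued as a plain power of \<open>U\<close>, and its gaps are then filled
  one after another, each between two adjacent letters \<open>U\<close>. The context
  \<open>x\<close>, \<open>y\<close> stays arbitrary and \<open>k\<close> depends on the cell alone,
  so that nested cells can be treated inside a partly filled parent.\<close>

lemma
  gap_word_insert: "gap_word p \<Longrightarrow> quiddity_word (x @ U # U # y) \<Longrightarrow> quiddity_word (x @ U # p @ U # y)" and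
  cell_word_insert: "cell_word a \<Longrightarrow> \<exists>k. \<forall>x y. quiddity_word (x @ replicate (3 * k + 3) U @ y) \<longrightarrow> quiddity_word (x @ a @ y)"
proof (induction arbitrary: x y and rule: gap_word_cell_word.inducts)
  case gap_word_Nil
  then show ?case by simp
next
  case (gap_word_wrap a)
  from gap_word_wrap(2) obtain k where
    k: "quiddity_word (x @ replicate (3 * k + 3) U @ y) \<Longrightarrow> quiddity_word (x @ a @ y)" for x y by auto
  from k[of "x @ [U,S]" "S # U # y"] quiddity_word_ear[OF gap_word_wrap(3), of k] show ?case by simp
next
  case (cell_word_single p q)
  show ?case
  proof (intro exI[of _ 0] allI impI)
    fix x y assume "quiddity_word (x @ replicate (3 * 0 + 3) U @ y)"
    then have "quiddity_word (x @ U # U # U # y)" by (simp add: numeral_3_eq_3)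
    from cell_word_single(3)[OF this] have "quiddity_word ((x @ U # p) @ U # U # y)" by simp
    from cell_word_single(4)[OF this] show "quiddity_word (x @ (U # p @ U # q @ [U]) @ y)" by simp
  qed
next
  case (cell_word_append p q a)
  from cell_word_append(6) obtain k where
    k: "quiddity_word (x @ replicate (3 * k + 3) U @ y) \<Longrightarrow> quiddity_word (x @ a @ y)" for x y by auto
  show ?case
  proof (intro exI[of _ "Suc k"] allI impI)
    fix x y assume "quiddity_word (x @ replicate (3 * Suc k + 3) U @ y)"
    then have "quiddity_word (x @ U # U # U # replicate (3 * k + 3) U @ y)" by (simp add: numeral_3_eq_3)
    from cell_word_append(4)[OF this] have "quiddity_word ((x @ U # p) @ U # U # replicate (3 * k + 3) U @ y)" by simp
    from cell_word_append(5)[OF this] have "quiddity_word ((x @ U # p @ U # q @ [U]) @ replicate (3 * k + 3) U @ y)" by simp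
    from k[OF this] show "quiddity_word (x @ (U # p @ U # q @ U # a) @ y)" by simp
  qed
qed

lemma root_word_insert:
  "root_word a \<Longrightarrow> \<exists>k. \<forall>x y. quiddity_word (x @ replicate (3 * k + 3) U @ y) \<longrightarrow> quiddity_word (x @ a @ y)"
proof (induction rule: root_word.induct)
  case (root_word_single p q)
  then show ?case using cell_word_insert[OF cell_word_single] by blast
next
  case (root_word_append p q r a)
  from root_word_append(5) obtain k where
    k: "quiddity_word (x @ replicate (3 * k + 3) U @ y) \<Longrightarrow> quiddity_word (x @ a @ y)" for x y by auto
  show ?case
  proof (intro exI[of _ "Suc k"] allI impI)
    fix x y assume "quiddity_word (x @ replicate (3 * Suc k + 3) U @ y)"
    \<comment> \<open>The fourth \<open>U\<close> is split off as the right neighbour of the gap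
      \<open>r\<close>; afterwards it rejoins the block that becomes \<open>a\<close>.\<close>
    then have "quiddity_word (x @ U # U # U # U # replicate (3 * k + 2) U @ y)" by (simp add: numeral_3_eq_3)
    from gap_word_insert[OF root_word_append(1) this]
    have "quiddity_word ((x @ U # p) @ U # U # U # replicate (3 * k + 2) U @ y)" by simp
    from gap_word_insert[OF root_word_append(2) this]
    have "quiddity_word ((x @ U # p @ U # q) @ U # U # replicate (3 * k + 2) U @ y)" by simp
    from gap_word_insert[OF root_word_append(3) this]
    have "quiddity_word ((x @ U # p @ U # q @ U # r) @ replicate (3 * k + 3) U @ y)" by (simp add: numeral_3_eq_3)
    from k[OF this] show "quiddity_word (x @ (U # p @ U # q @ U # r @ a) @ y)" by simp
  qed
qed

lemma root_word_imp_ear_quiddity_word: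
  assumes "root_word w"
  shows "quiddity_word w"
proof -
  from root_word_insert[OF assms] obtain k
    where k: "quiddity_word (x @ replicate (3 * k + 3) U @ y) \<Longrightarrow> quiddity_word (x @ w @ y)" for x y by auto
  have "quiddity_word (replicate (3 * k + 3) U)"
    unfolding quiddity_word_def using ear_quiddity_cell[of k] word_of_ones[of "3 * k + 3"] by metis
  then show ?thesis using k[of "[]" "[]"] by simp
qed

section \<open>Reduction to normal form\<close>

text \<open>
  The stack \<open>[c\<^sub>t, \<dots>, c\<^sub>0]\<close> is the normal form \<open>U^c\<^sub>0 S \<dots> S U^c\<^sub>t\<close> of an element of the free product.
\<close>

fun stack_step :: "letter \<Rightarrow> nat list \<Rightarrow> nat list" where
  "stack_step _ [] = []"
| "stack_step U (c # cs) = (c + 1) mod 3 # cs"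
| "stack_step S (c # cs) = (if c = 0 \<and> cs \<noteq> [] then cs else 0 # c # cs)"

text \<open>Only the outer exponents of a normal form, the top and the bottom of the stack, may be
  0, since the element may end or begin with \<open>S\<close>. A 0 in between would leave
  \<open>SS\<close> uncancelled.\<close>

definition reduced_stack :: "nat list \<Rightarrow> bool" where
  "reduced_stack s \<longleftrightarrow> s \<noteq> [] \<and> (\<forall>c\<in>set s. c < 3) \<and> 0 \<notin> set (butlast (tl s))"

lemma reduced_stack_step:
  assumes "reduced_stack s"
  shows "reduced_stack (stack_step l s)"
proof -
  obtain c cs where s: "s = c # cs" using assms by (cases s) (auto simp: reduced_stack_def)
  show ?thesis
  proof (cases l)
    case U
    then show ?thesis using assms s by (auto simp: reduced_stack_def)
  next
    case S
    have "set (butlast (tl cs)) \<subseteq> set (butlast cs)" by (cases cs) auto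
    then show ?thesis using assms s S by (auto simp: reduced_stack_def)
  qed
qed

lemma reduced_stack_fold: "reduced_stack s \<Longrightarrow> reduced_stack (fold stack_step w s)"
  by (induction w arbitrary: s) (auto simp: reduced_stack_step)

lemma fold_stack_step_UUU:
  assumes "reduced_stack s"
  shows "fold stack_step (replicate (3 * k + 3) U) s = s"
proof -
  obtain c cs where s: "s = c # cs" "c < 3"
    using assms by (cases s) (auto simp: reduced_stack_def)
  have "fold stack_step (replicate n U) s = (c + n) mod 3 # cs" for n
    by (induction n) (use s in \<open>auto simp flip: replicate_append_same simp: mod_simps\<close>)
  then have "fold stack_step (replicate (3 * k + 3) U) s = (c + (3 * k + 3)) mod 3 # cs" .
  also have "(c + (3 * k + 3)) mod 3 = c" using s by presburger
  finally show ?thesis using s by simp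
qed

text \<open>This is \<open>S U^(3k + 3) S = 1\<close>. Reducedness is needed for
  \<open>SS = 1\<close>: if the first \<open>S\<close> pops a 0, the entry uncovered must be nonzero
  or the bottom for the second \<open>S\<close> to push it back.\<close>

lemma fold_stack_step_ear:
  assumes "reduced_stack s"
  shows "fold stack_step (S # replicate (3 * k + 3) U @ [S]) s = s"
proof -
  obtain c cs where s: "s = c # cs" "c < 3"
    using assms by (cases s) (auto simp: reduced_stack_def)
  have "fold stack_step (replicate (3 * k + 3) U) (stack_step S s) = stack_step S s"
    by (intro fold_stack_step_UUU reduced_stack_step assms)
  moreover have "stack_step S (stack_step S s) = s"
    using assms s by (cases cs) (auto simp: reduced_stack_def split: if_splits)
  ultimately show ?thesis by simp
qed

text \<open>Every ear inserts a factor that acts trivially, so quiddities have words equal to 1 in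
  the free product.\<close>

lemma ear_quiddity_stack: "ear_quiddity m a \<Longrightarrow> fold stack_step (word_of a) [0] = [0]"
proof (induction rule: ear_quiddity.induct)
  case (ear_quiddity_cell k)
  then show ?case using fold_stack_step_UUU[of "[0]" k]
    by (simp only: word_of_ones) (simp add: reduced_stack_def)
next
  case (ear_quiddity_ear m xs a b ys k)
  have nz: "a > 0" "b > 0" using ear_quiddity_props[OF ear_quiddity_ear(1)] by auto
  have "word_of (xs @ [Suc a] @ replicate (3 * k + 1) 1 @ [Suc b] @ ys)
     = word_of xs @ (word_of [a] @ [S, U]) @ replicate (3 * k + 1) U @ ([U, S] @ word_of [b]) @ word_of ys"
    by (simp only: word_of_append word_of_ones word_of_Suc(1)[OF nz(1)] word_of_Suc(2)[OF nz(2)])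
  also have "\<dots> = word_of (xs @ [a]) @ (S # replicate (3 * k + 3) U @ [S]) @ word_of ([b] @ ys)"
    by (simp add: numeral_3_eq_3 replicate_app_Cons_same)
  also have "fold stack_step \<dots> [0] = fold stack_step (word_of (xs @ [a, b] @ ys)) [0]"
    using fold_stack_step_ear[OF reduced_stack_fold[of "[0]" "word_of (xs @ [a])"], of k]
    by (simp add: reduced_stack_def)
  finally show ?case using ear_quiddity_ear by simp
qed

section \<open>Reduction as a parse\<close>

abbreviation no_SS :: "letter list \<Rightarrow> bool" where
  "no_SS \<equiv> successively (\<lambda>x y. x = U \<or> y = U)"

lemma last_SU: "last (U # concat (replicate k [S, U])) = U"
  by (induction k) auto

lemma no_SS_word_of: "no_SS (word_of a)"
proof (induction a)
  case (Cons a as)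
  have "no_SS (U # concat (replicate k [S, U]))" for k
    by (induction k) (auto simp: successively_Cons)
  then have "no_SS ((U # concat (replicate (a - 1) [S, U])) @ word_of as)"
    using Cons last_SU by (subst successively_append_iff) blast
  then show ?case by simp
qed simp

lemma last_word_of: "a \<noteq> [] \<Longrightarrow> last (word_of a) = U"
proof (induction a)
  case (Cons a as)
  have *: "word_of (a # as) = (U # concat (replicate (a - 1) [S, U])) @ word_of as" by simp
  show ?case
  proof (cases as)
    case Nil
    then show ?thesis unfolding * using last_SU[of "a - 1"] by (simp only: word_of.simps append_Nil2)
  next
    case (Cons b bs)
    then have "word_of as \<noteq> []" by simp
    then have "last (word_of (a # as)) = last (word_of as)" unfolding * by (subst last_append) simp
    then show ?thesis using Cons Cons.IH by simp
  qed
qed simp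

text \<open>The rules extend words on the left, but reduction reads from left to right and completes
  triples on the right.\<close>

lemma cell_word_snoc: "cell_word a \<Longrightarrow> gap_word p \<Longrightarrow> gap_word q \<Longrightarrow> cell_word (a @ U # p @ U # q @ [U])"
proof (induction a rule: gap_word_cell_word.inducts(2)[where ?P1.0 = "\<lambda>_. True"])
  case (cell_word_single p' q')
  then show ?case using cell_word_append[OF cell_word_single(1,3) gap_word_cell_word.cell_word_single[of p q]] by simp
next
  case (cell_word_append p' q' a)
  then show ?case using gap_word_cell_word.cell_word_append[of p' q' "a @ U # p @ U # q @ [U]"] by simp
qed simp_all

lemma root_word_snoc: "root_word a \<Longrightarrow> gap_word r \<Longrightarrow> gap_word p \<Longrightarrow> gap_word q \<Longrightarrow> root_word (a @ r @ U # p @ U # q @ [U])"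
proof (induction rule: root_word.induct)
  case (root_word_single p' q')
  then show ?case using root_word_append[OF root_word_single(1,2,3) root_word.root_word_single[of p q]] by simp
next
  case (root_word_append p' q' r' a)
  then show ?case using root_word.root_word_append[of p' q' r' "a @ r @ U # p @ U # q @ [U]"] by simp
qed

text \<open>The completed triples of a partially read cell, where \<open>b\<close> marks the root.
  Only in the root may a gap follow a completed triple; in any other cell an \<open>S\<close> there
  closes the cell.\<close>

definition frame_base :: "bool \<Rightarrow> letter list \<Rightarrow> bool" where
  "frame_base b x \<longleftrightarrow> x = [] \<or>
     (if b then \<exists>a r. root_word a \<and> gap_word r \<and> x = a @ r else cell_word x)"

text \<open>\<open>c\<close> is the number of the cell's own letters \<open>U\<close> modulo 3, so
  it coincides with the stack entry of the cell.\<close>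

definition frame :: "bool \<Rightarrow> nat \<Rightarrow> letter list \<Rightarrow> bool" where
  "frame b c x \<longleftrightarrow>
     c = 0 \<and> frame_base b x \<or>
     c = 1 \<and> (\<exists>a p. frame_base b a \<and> gap_word p \<and> x = a @ U # p) \<or>
     c = 2 \<and> (\<exists>a p q. frame_base b a \<and> gap_word p \<and> gap_word q \<and> x = a @ U # p @ U # q)"

text \<open>The prefix of a parse: one partially read cell per entry of the stack, the root cell at the bottom.\<close>

inductive parsed :: "nat list \<Rightarrow> letter list \<Rightarrow> bool" where
  parsed_root: "frame True c x \<Longrightarrow> parsed [c] x"
| parsed_push: "parsed (c # cs) w \<Longrightarrow> c \<noteq> 0 \<or> cs = [] \<Longrightarrow> w \<noteq> [] \<Longrightarrow> last w = U \<Longrightarrow>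
     frame False d x \<Longrightarrow> parsed (d # c # cs) (w @ S # x)"

lemma frame_base_snoc:
  assumes "frame_base b a" "gap_word p" "gap_word q"
  shows "frame_base b (a @ U # p @ U # q @ [U])"
proof (cases b)
  case True
  have "root_word (a @ U # p @ U # q @ [U])"
    using assms True root_word_snoc root_word_single by (auto simp: frame_base_def)
  then show ?thesis using True gap_word_Nil unfolding frame_base_def by (metis append_Nil2)
next
  case False
  then show ?thesis using assms cell_word_snoc cell_word_single by (auto simp: frame_base_def)
qed

lemma frame_U:
  assumes "frame b c x"
  shows "frame b ((c + 1) mod 3) (x @ [U])"
  using assms unfolding frame_def[of _ c]
proof (elim disjE conjE exE)
  assume "c = 0" "frame_base b x"
  then show ?thesis using gap_word_Nil by (auto simp: frame_def)
next
  fix a p assume "c = 1" "frame_base b a" "gap_word p" "x = a @ U # p"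
  then show ?thesis using gap_word_Nil by (auto simp: frame_def)
next
  fix a p q assume "c = 2" "frame_base b a" "gap_word p" "gap_word q" "x = a @ U # p @ U # q"
  then show ?thesis using frame_base_snoc[of b a p q] by (simp add: frame_def)
qed

lemma parsed_U:
  assumes "parsed (c # cs) w"
  shows "parsed ((c + 1) mod 3 # cs) (w @ [U])"
  using assms
proof cases
  case parsed_root
  then show ?thesis using frame_U parsed.parsed_root by simp
next
  case (parsed_push c' cs' w' x)
  from parsed.parsed_push[OF parsed_push(3-6) frame_U[OF parsed_push(7)]] parsed_push(1,2)
  show ?thesis by simp
qed

text \<open>A nonempty gap word ends with \<open>S\<close>; hence right after a letter
  \<open>U\<close> the current gap is still empty.\<close>

lemma gap_word_last_U: "gap_word p \<Longrightarrow> x @ p \<noteq> [] \<Longrightarrow> last (x @ p) = U \<Longrightarrow> p = []"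
  using gap_word_start[of p] by auto

text \<open>The second premise singles out the places where the grammar provides a gap: anywhere in
  the root, and after an incomplete triple in other cells.\<close>

lemma frame_trailing:
  assumes "frame b c x" "c \<noteq> 0 \<or> b" "x \<noteq> []" "last x = U" "gap_word p"
  shows "frame b c (x @ p)"
  using assms(1) unfolding frame_def[of _ _ x]
proof (elim disjE conjE exE)
  assume c: "c = 0" "frame_base b x"
  with assms obtain a r where a: "root_word a" "gap_word r" "x = a @ r" by (auto simp: frame_base_def)
  with assms have "r = []" using gap_word_last_U by blast
  with a c assms show ?thesis by (auto simp: frame_def frame_base_def)
next
  fix a q assume c: "c = 1" "frame_base b a" "gap_word q" "x = a @ U # q"
  have "q = []" by (rule gap_word_last_U[of q "a @ [U]"]) (use c(3,4) assms(4) in auto)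
  then have "x @ p = a @ U # p" using c(4) by simp
  then show ?thesis unfolding frame_def using c(1,2) assms(5) by blast
next
  fix a q r assume c: "c = 2" "frame_base b a" "gap_word q" "gap_word r" "x = a @ U # q @ U # r"
  have "r = []" by (rule gap_word_last_U[of r "a @ U # q @ [U]"]) (use c(4,5) assms(4) in auto)
  then have "x @ p = a @ U # q @ U # p" using c(5) by simp
  then show ?thesis unfolding frame_def using c(1-3) assms(5) by blast
qed

lemma parsed_trailing:
  assumes "parsed (c # cs) w" "c \<noteq> 0 \<or> cs = []" "w \<noteq> []" "last w = U" "gap_word p"
  shows "parsed (c # cs) (w @ p)"
  using assms(1)
proof cases
  case parsed_root
  then show ?thesis using assms frame_trailing parsed.parsed_root by simp
next
  case (parsed_push c' cs' w' x)
  have c: "c \<noteq> 0" using assms(2) parsed_push by simp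
  have "x \<noteq> []" using assms(4) parsed_push by auto
  then have "frame False c (x @ p)" using parsed_push c assms by (intro frame_trailing) auto
  from parsed.parsed_push[OF parsed_push(3-6) this] parsed_push(1,2) show ?thesis by simp
qed

text \<open>On a nonzero or bottom entry the letter opens a new cell. Otherwise it closes the top
  cell, which consists of whole triples and becomes the gap word of the cell below.\<close>

lemma parsed_S:
  assumes "parsed (c # cs) w" "w \<noteq> []" "last w = U"
  shows "parsed (stack_step S (c # cs)) (w @ [S])"
proof (cases "c = 0 \<and> cs \<noteq> []")
  case False
  have "frame False 0 []" by (simp add: frame_def frame_base_def)
  with parsed_push[OF assms(1) _ assms(2,3) this] False show ?thesis by auto
next
  case True
  from assms(1) show ?thesis
  proof cases
    case parsed_root
    with True show ?thesis by simp
  next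
    case (parsed_push c' cs' w' x)
    \<comment> \<open>\<open>x\<close> is not empty, as otherwise the word read so far would end
      with the opening \<open>S\<close>.\<close>
    have "cell_word x" using parsed_push True assms by (auto simp: frame_def frame_base_def)
    from gap_word_wrap[OF this] have "parsed (c' # cs') (w' @ S # x @ [S])"
      using parsed_trailing parsed_push by simp
    then show ?thesis using parsed_push True by simp
  qed
qed

lemma parsed_nonempty: "parsed s w \<Longrightarrow> s \<noteq> []"
  by (cases rule: parsed.cases) auto

text \<open>The normal form and the parse use the same stack, so reducing a word already parses
  it.\<close>

lemma parsed_fold:
  assumes "no_SS w" "w = [] \<or> hd w = U"
  shows "parsed (fold stack_step w [0]) w"
  using assms
proof (induction w rule: rev_induct)
  case Nil
  then show ?case by (auto intro!: parsed_root simp: frame_def frame_base_def)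
next
  case (snoc l w)
  have "no_SS w" using snoc.prems by (simp add: successively_append_iff)
  then have "parsed (fold stack_step w [0]) w"
    using snoc.prems(2) by (intro snoc.IH) (cases w; simp)+
  moreover then obtain c cs where "fold stack_step w [0] = c # cs"
    using parsed_nonempty by (cases "fold stack_step w [0]") auto
  ultimately have p: "parsed (c # cs) w" "fold stack_step w [0] = c # cs" by auto
  show ?case
  proof (cases l)
    case U
    with p parsed_U show ?thesis by simp
  next
    case S
    then have "w \<noteq> []" using snoc.prems(2) by auto
    moreover from this have "last w = U" using snoc.prems(1) S by (simp add: successively_append_iff)
    ultimately show ?thesis using p S parsed_S by simp
  qed
qed

lemma ear_quiddity_imp_root_word:
  assumes "ear_quiddity m a"
  shows "root_word (word_of a)"
proof -
  have ne: "a \<noteq> []" using ear_quiddity_props[OF assms] by auto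
  then have hd: "word_of a \<noteq> []" "hd (word_of a) = U" by (cases a; simp)+
  have "parsed [0] (word_of a)"
    \<comment> \<open>A trivial word leaves the stack \<open>[0]\<close>: only the root cell is
      open, and all its triples are complete.\<close>
    using parsed_fold[OF no_SS_word_of[of a]] hd ear_quiddity_stack[OF assms] by simp
  then have "frame_base True (word_of a)" by cases (auto simp: frame_def)
  then obtain b r where "root_word b" "gap_word r" "word_of a = b @ r" using hd by (auto simp: frame_base_def)
  then show ?thesis using gap_word_last_U[of r b] last_word_of[OF ne] hd by simp
qed

section \<open>Cutting an ear off a dissection\<close>

lemma sides_iff:
  "p < q \<Longrightarrow> {p, q} \<in> sides C \<longleftrightarrow> p \<in> C \<and> q \<in> C \<and> (C \<inter> {p<..<q} = {} \<or> C \<subseteq> {p..q})"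
  unfolding sides_def by (auto simp: doubleton_eq_iff)

lemma diagonals_iff:
  "p < q \<Longrightarrow> {p, q} \<in> diagonals C \<longleftrightarrow> p \<in> C \<and> q \<in> C \<and> C \<inter> {p<..<q} \<noteq> {} \<and> \<not> C \<subseteq> {p..q}"
  unfolding diagonals_def by (auto simp: doubleton_eq_iff sides_iff)

lemma sidesE:
  assumes "e \<in> sides C"
  obtains p q where "p < q" "e = {p, q}" "p \<in> C" "q \<in> C"
  using assms unfolding sides_def by auto

lemma diagonalsE:
  assumes "e \<in> diagonals C"
  obtains p q where "p < q" "e = {p, q}" "p \<in> C" "q \<in> C"
  using assms unfolding diagonals_def by auto

lemma sides_interval_iff:
  assumes "p < q"
  shows "{p, q} \<in> sides {a..b} \<longleftrightarrow> a \<le> p \<and> q \<le> b \<and> (q = Suc p \<or> p = a \<and> q = b)"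
proof -
  have "{a..b} \<inter> {p<..<q} = {} \<longleftrightarrow> q = Suc p" if "a \<le> p" "q \<le> b"
  proof
    assume "{a..b} \<inter> {p<..<q} = {}"
    then have "Suc p \<notin> {a..b} \<inter> {p<..<q}" by blast
    then show "q = Suc p" using assms that by auto
  qed auto
  moreover have "{a..b} \<subseteq> {p..q} \<longleftrightarrow> p = a \<and> q = b" if "a \<le> p" "q \<le> b"
    using assms that by auto
  ultimately show ?thesis using assms by (auto simp: sides_iff)
qed

lemma sides_polygon_iff:
  "p < q \<Longrightarrow> {p, q} \<in> sides (polygon n) \<longleftrightarrow> q \<le> n + 1 \<and> (q = Suc p \<or> p = 0 \<and> q = n + 1)"
  by (simp add: polygon_def sides_interval_iff)

lemma diagonals_polygon_iff:
  assumes "p < q"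
  shows "{p, q} \<in> diagonals (polygon n) \<longleftrightarrow> q \<le> n + 1 \<and> q \<noteq> Suc p \<and> \<not> (p = 0 \<and> q = n + 1)"
proof -
  have "{p, q} \<in> diagonals (polygon n) \<longleftrightarrow> p \<in> polygon n \<and> q \<in> polygon n \<and> {p, q} \<notin> sides (polygon n)"
    using assms by (auto simp: diagonals_iff sides_iff)
  then show ?thesis unfolding sides_polygon_iff[OF assms] using assms by (auto simp: polygon_def)
qed

lemma strict_mono_pair_image:
  fixes f :: "nat \<Rightarrow> nat"
  assumes "strict_mono f" "f ` d = {x, y}"
  obtains p q where "d = {p, q}" "f p = x" "f q = y"
proof -
  obtain p q where pq: "p \<in> d" "f p = x" "q \<in> d" "f q = y" using assms(2) by (metis imageE insertCI)
  have "d = {p, q}"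
    using assms pq inj_image_eq_iff[OF strict_mono_imp_inj_on[OF assms(1)], of d "{p, q}"] by auto
  with pq that show ?thesis by blast
qed

lemma sides_image_iff:
  fixes f :: "nat \<Rightarrow> nat"
  assumes "strict_mono f" "p < q"
  shows "{f p, f q} \<in> sides (f ` C) \<longleftrightarrow> {p, q} \<in> sides C"
proof -
  have "f ` C \<inter> {f p<..<f q} = {} \<longleftrightarrow> C \<inter> {p<..<q} = {}"
    using assms by (auto simp: strict_mono_less disjoint_iff)
  moreover have "f ` C \<subseteq> {f p..f q} \<longleftrightarrow> C \<subseteq> {p..q}"
    using assms by (auto simp: strict_mono_less_eq)
  moreover have "f x \<in> f ` C \<longleftrightarrow> x \<in> C" for x
    using strict_mono_imp_inj_on[OF assms(1)] by (simp add: inj_image_mem_iff)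
  ultimately show ?thesis using assms by (simp add: sides_iff strict_mono_less)
qed

lemma sides_image:
  fixes f :: "nat \<Rightarrow> nat"
  assumes "strict_mono f"
  shows "sides (f ` C) = (`) f ` sides C"
proof (intro set_eqI iffI)
  fix e assume e: "e \<in> sides (f ` C)"
  then obtain p q where "f p < f q" "e = {f p, f q}" by (elim sidesE) auto
  moreover then have "p < q" using assms by (simp add: strict_mono_less)
  ultimately have "{p, q} \<in> sides C" "e = f ` {p, q}" using e assms by (auto simp: sides_image_iff)
  then show "e \<in> (`) f ` sides C" by blast
next
  fix e assume "e \<in> (`) f ` sides C"
  then obtain d where "d \<in> sides C" "e = f ` d" by blast
  moreover then obtain p q where "p < q" "d = {p, q}" by (elim sidesE)
  ultimately show "e \<in> sides (f ` C)" using assms by (simp add: sides_image_iff)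
qed

lemma diagonals_image:
  fixes f :: "nat \<Rightarrow> nat"
  assumes "strict_mono f"
  shows "diagonals (f ` C) = (`) f ` diagonals C"
proof -
  have inj: "inj ((`) f)" using strict_mono_imp_inj_on[OF assms] by (intro injI) (metis inj_image_eq_iff)
  have "{{i, j} |i j. i \<in> f ` C \<and> j \<in> f ` C \<and> i < j} = (`) f ` {{i, j} |i j. i \<in> C \<and> j \<in> C \<and> i < j}"
    (is "?A = ?B")
  proof (intro set_eqI iffI)
    fix e assume "e \<in> ?A"
    then obtain p q where "p \<in> C" "q \<in> C" "f p < f q" "e = {f p, f q}" by auto
    moreover then have "p < q" using assms by (simp add: strict_mono_less)
    ultimately show "e \<in> ?B" by (auto intro!: image_eqI[of _ _ "{p, q}"])
  next
    fix e assume "e \<in> ?B"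
    then obtain p q where "p \<in> C" "q \<in> C" "p < q" "e = {f p, f q}" by auto
    moreover then have "f p < f q" using assms by (simp add: strict_mono_less)
    ultimately show "e \<in> ?A" by blast
  qed
  then show ?thesis unfolding diagonals_def sides_image[OF assms]
    by (simp add: image_set_diff[OF inj])
qed

lemma crossing_image_iff:
  fixes f :: "nat \<Rightarrow> nat"
  assumes "strict_mono f"
  shows "crossing (f ` d) (f ` e) \<longleftrightarrow> crossing d e"
proof
  have *: "crossing d e" if "i < k" "k < j" "j < l" "f ` d = {i, j}" "f ` e = {k, l}" for i j k l d e
  proof -
    from strict_mono_pair_image[OF assms that(4)] obtain i' j' where d: "d = {i', j'}" "f i' = i" "f j' = j" .
    from strict_mono_pair_image[OF assms that(5)] obtain k' l' where e: "e = {k', l'}" "f k' = k" "f l' = l" .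
    have "i' < k'" "k' < j'" "j' < l'" using that(1-3) d e assms by (auto simp: strict_mono_less)
    then show ?thesis using d e unfolding crossing_def by blast
  qed
  assume "crossing (f ` d) (f ` e)"
  then obtain i j k l where h: "i < k" "k < j" "j < l"
    "(f ` d = {i, j} \<and> f ` e = {k, l}) \<or> (f ` e = {i, j} \<and> f ` d = {k, l})"
    unfolding crossing_def by blast
  have "crossing d e \<or> crossing e d" using *[OF h(1-3), of d e] *[OF h(1-3), of e d] h(4) by blast
  then show "crossing d e" unfolding crossing_def by blast
next
  assume "crossing d e"
  then obtain i j k l where h: "i < k" "k < j" "j < l"
    "(d = {i, j} \<and> e = {k, l}) \<or> (e = {i, j} \<and> d = {k, l})"
    unfolding crossing_def by blast
  then have "f i < f k" "f k < f j" "f j < f l" using assms by (auto simp: strict_mono_less)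
  moreover have "(f ` d = {f i, f j} \<and> f ` e = {f k, f l}) \<or> (f ` e = {f i, f j} \<and> f ` d = {f k, f l})"
    using h(4) by auto
  ultimately show "crossing (f ` d) (f ` e)" unfolding crossing_def by blast
qed

section \<open>Walking around a sub-polygon\<close>

lemma side_Min_Max:
  assumes "finite C" "x \<in> C" "y \<in> C" "x < y"
  shows "Min C < Max C" "{Min C, Max C} \<in> sides C"
proof -
  have "Min C \<le> x" "y \<le> Max C" using assms by auto
  then show l: "Min C < Max C" using assms(4) by linarith
  have "C \<noteq> {}" using assms by auto
  moreover have "C \<subseteq> {Min C..Max C}" using assms by auto
  ultimately show "{Min C, Max C} \<in> sides C" using l assms by (simp add: sides_iff)
qed

lemma side_succ:
  assumes "finite C" "x \<in> C" "z \<in> C" "x < z"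
  obtains y where "x < y" "y \<le> z" "{x, y} \<in> sides C" "y \<in> C" "C \<inter> {x<..<y} = {}"
proof -
  let ?A = "{y \<in> C. x < y}"
  have A: "finite ?A" "z \<in> ?A" using assms by auto
  have in_A: "Min ?A \<in> ?A" using A Min_in by blast
  have "Min ?A \<le> v" if "v \<in> ?A" for v using A(1) that by (rule Min_le)
  then have gap: "C \<inter> {x<..<Min ?A} = {}" by fastforce
  have "Min ?A \<le> z" using A by simp
  with in_A gap show ?thesis using that[of "Min ?A"] assms by (simp add: sides_iff)
qed

lemma side_pred:
  assumes "finite C" "x \<in> C" "z \<in> C" "z < x"
  obtains y where "y < x" "z \<le> y" "{y, x} \<in> sides C" "y \<in> C"
proof -
  let ?A = "{y \<in> C. y < x}"
  have A: "finite ?A" "z \<in> ?A" using assms by auto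
  have in_A: "Max ?A \<in> ?A" using A Max_in by blast
  have "v \<le> Max ?A" if "v \<in> ?A" for v using A(1) that by (rule Max_ge)
  then have gap: "C \<inter> {Max ?A<..<x} = {}" by fastforce
  have "z \<le> Max ?A" using A by simp
  with in_A gap show ?thesis using that[of "Max ?A"] assms by (simp add: sides_iff)
qed

text \<open>With three or more vertices the closing side from minimum to maximum is no unit step, so
  it must be the exceptional side \<open>{a, b}\<close>. All other sides are unit steps, and
  following them from \<open>a\<close> reaches every vertex up to \<open>b\<close>.\<close>

lemma interval_if_sides_short:
  fixes a b :: nat
  assumes "card C \<ge> 3"
    and short: "\<And>p q. p < q \<Longrightarrow> {p, q} \<in> sides C \<Longrightarrow> q = Suc p \<or> p = a \<and> q = b"
  shows "C = {a..b}"
proof -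
  have fin: "finite C" using assms(1) by (metis card.infinite not_numeral_le_zero)
  have no2: "\<not> C \<subseteq> {x, y}" for x y
    using assms(1) card_mono[of "{x, y}" C] card_length[of "[x, y]"] by auto
  obtain x where x: "x \<in> C" using no2 by blast
  obtain y where y: "y \<in> C" "y \<noteq> x" using no2[of x x] by blast
  have m: "Min C < Max C" "{Min C, Max C} \<in> sides C"
    using side_Min_Max[OF fin] x y by (metis linorder_neqE_nat)+
  have sub: "C \<subseteq> {Min C..Max C}" using fin by auto
  have "Max C \<noteq> Suc (Min C)"
  proof
    assume "Max C = Suc (Min C)"
    then have "C \<subseteq> {Min C, Suc (Min C)}" using sub by (auto dest!: subsetD)
    then show False using no2 by blast
  qed
  then have ab: "Min C = a" "Max C = b" using short[OF m] by auto
  have mem: "a \<in> C" "b \<in> C" "a < b" using ab m(1) Min_in[OF fin] Max_in[OF fin] x by auto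
  have step: "Suc z \<in> C" if z: "z \<in> C" "z < b" for z
  proof -
    obtain y where y: "z < y" "y \<le> b" "{z, y} \<in> sides C" "y \<in> C" "C \<inter> {z<..<y} = {}"
      using side_succ[OF fin z(1) mem(2) z(2)] .
    have "\<not> (z = a \<and> y = b)"
    proof
      assume zy: "z = a \<and> y = b"
      have "C \<subseteq> {a, b}"
      proof
        fix c assume "c \<in> C"
        then have "c \<in> {a..b}" "c \<notin> {a<..<b}" using sub ab y(5) zy by auto
        then show "c \<in> {a, b}" by auto
      qed
      then show False using no2 by blast
    qed
    then show ?thesis using short[OF y(1,3)] y by auto
  qed
  have "z \<in> C" if "a \<le> z" "z \<le> b" for z
    using that by (induction z rule: dec_induct) (use mem step in auto)
  then show ?thesis using sub ab by auto
qed


lemma cells_empty: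
  assumes "n \<ge> 1"
  shows "cells n {} = {polygon n}"
proof (intro set_eqI iffI)
  fix C assume "C \<in> cells n {}"
  then have C: "card C \<ge> 3" "sides C \<subseteq> sides (polygon n)" by (auto simp: cells_def)
  have "C = {0..n+1}"
    using C(1) by (rule interval_if_sides_short) (use C(2) sides_polygon_iff in blast)
  then show "C \<in> {polygon n}" by (simp add: polygon_def)
next
  fix C assume "C \<in> {polygon n}"
  then show "C \<in> cells n {}" using assms by (simp add: cells_def polygon_def)
qed

text \<open>
  A polygon with \<open>r + 2\<close> vertices is glued to the side \<open>{i, i + 1}\<close>, and \<open>f\<close> relabels the old vertices.
\<close>

locale ear =
  fixes n' i r :: nat and D' :: "nat set set"
  assumes n': "n' \<ge> 1" and i: "i \<le> n'" and r: "r \<ge> 1"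
    and D': "D' \<subseteq> diagonals (polygon n')"
begin

definition "n = n' + r"
definition "j = i + r + 1"
definition f :: "nat \<Rightarrow> nat" where "f v = (if v \<le> i then v else v + r)"
definition "D = insert {i, j} ((`) f ` D')"

lemma f_mono: "strict_mono f"
  by (auto simp: strict_mono_def f_def)

lemma inj_f: "inj f"
  using f_mono by (rule strict_mono_imp_inj_on)

lemma f_polygon: "f ` polygon n' = polygon n - {i<..<j}"
proof (intro set_eqI iffI)
  fix v assume "v \<in> f ` polygon n'"
  then show "v \<in> polygon n - {i<..<j}" using i by (auto simp: f_def polygon_def n_def j_def)
next
  fix v assume v: "v \<in> polygon n - {i<..<j}"
  show "v \<in> f ` polygon n'"
  proof (cases "v \<le> i")
    case True
    then show ?thesis using i by (intro image_eqI[of _ _ v]) (auto simp: f_def polygon_def)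
  next
    case False
    then show ?thesis using v
      by (intro image_eqI[of _ _ "v - r"]) (auto simp: f_def polygon_def j_def n_def)
  qed
qed

lemma f_not_inside: "f v \<notin> {i<..<j}"
  by (auto simp: f_def j_def)

text \<open>The side \<open>{i, i + 1}\<close> that carries the ear becomes the chord
  \<open>{i, j}\<close>; every other side stays a side.\<close>

lemma sides_polygon_f_iff:
  assumes "p < q" "q \<le> n' + 1"
  shows "{f p, f q} \<in> sides (polygon n) \<or> {f p, f q} = {i, j} \<longleftrightarrow> {p, q} \<in> sides (polygon n')"
proof -
  have less: "f p < f q" using f_mono assms(1) by (simp add: strict_mono_less)
  have "i < j" by (simp add: j_def)
  then have "{f p, f q} = {i, j} \<longleftrightarrow> f p = i \<and> f q = j" using less by (auto simp: doubleton_eq_iff)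
  then show ?thesis using assms i r n' unfolding sides_polygon_iff[OF less] sides_polygon_iff[OF assms(1)]
    by (auto simp: f_def n_def j_def split: if_splits)
qed

lemma ij_f: "{i, j} = f ` {i, Suc i}"
  by (auto simp: f_def j_def)

lemma short_not_diagonal: "{i, Suc i} \<notin> diagonals C"
  using diagonals_iff[of i "Suc i" C] by auto

lemma D'_pair:
  assumes "e \<in> D'"
  obtains p q where "p < q" "q \<le> n' + 1" "e = {p, q}" "{p, q} \<notin> sides (polygon n')"
proof -
  have "e \<in> diagonals (polygon n')" using assms D' by blast
  moreover then obtain p q where "p < q" "e = {p, q}" "p \<in> polygon n'" "q \<in> polygon n'" by (rule diagonalsE)
  ultimately show ?thesis using that[of p q] by (simp add: diagonals_def polygon_def)
qed

text \<open>The new chord is the image of \<open>{i, i + 1}\<close>. As a side of a cell it was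
  allowed before, and it is never a diagonal of a relabelled cell, so neither condition on cells
  changes.\<close>

lemma f_cell_iff:
  assumes "C' \<subseteq> polygon n'"
  shows "f ` C' \<in> cells n D \<longleftrightarrow> C' \<in> cells n' D'"
proof -
  have inj': "f ` x = f ` y \<longleftrightarrow> x = y" for x y using inj_f by (simp add: inj_image_eq_iff)
  have ij': "{i, j} \<noteq> f ` e" if "e \<in> diagonals C'" for e
    using that short_not_diagonal unfolding ij_f inj' by auto
  have "sides (f ` C') \<subseteq> sides (polygon n) \<union> D \<longleftrightarrow> sides C' \<subseteq> sides (polygon n') \<union> D'"
  proof -
    have "f ` e \<in> sides (polygon n) \<union> D \<longleftrightarrow> e \<in> sides (polygon n') \<union> D'" if e: "e \<in> sides C'" for e
    proof -
      obtain p q where pq: "p < q" "e = {p, q}" "p \<in> C'" "q \<in> C'" using e by (rule sidesE)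
      then have "q \<le> n' + 1" using assms by (auto simp: polygon_def)
      from sides_polygon_f_iff[OF pq(1) this]
      have "f ` e \<in> sides (polygon n) \<or> f ` e = {i, j} \<longleftrightarrow> e \<in> sides (polygon n')"
        using pq by simp
      moreover have "f ` e \<in> (`) f ` D' \<longleftrightarrow> e \<in> D'" using inj' by auto
      ultimately show ?thesis unfolding D_def by blast
    qed
    then show ?thesis unfolding sides_image[OF f_mono] by blast
  qed
  moreover have "diagonals (f ` C') \<inter> D = {} \<longleftrightarrow> diagonals C' \<inter> D' = {}"
    unfolding diagonals_image[OF f_mono] D_def using ij' inj' by auto
  moreover have "f ` C' \<subseteq> polygon n" using assms f_polygon by blast
  moreover have "card (f ` C') = card C'" using inj_f by (simp add: card_image inj_on_subset)
  ultimately show ?thesis using assms unfolding cells_def by simp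
qed

lemma D_not_inside:
  assumes "e \<in> D"
  shows "e \<inter> {i<..<j} = {}"
  using assms f_not_inside unfolding D_def by fastforce

lemma i_less_j: "i < j" by (simp add: j_def)

lemma ij_not_outer: "\<not> (i = 0 \<and> j = n + 1)"
  using n' by (auto simp: j_def n_def)

lemma j_le: "j \<le> n + 1"
  using i by (simp add: j_def n_def)

lemma D_inside:
  assumes "{p, q} \<in> D" "p < q" "i \<le> p" "q \<le> j"
  shows "p = i \<and> q = j"
  using D_not_inside[OF assms(1)] assms by auto

lemma ear_cell: "{i..j} \<in> cells n D"
proof -
  have "sides {i..j} \<subseteq> sides (polygon n) \<union> D"
  proof
    fix e assume e: "e \<in> sides {i..j}"
    then obtain p q where "p < q" "e = {p, q}" by (rule sidesE)
    then show "e \<in> sides (polygon n) \<union> D"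
      using e j_le by (auto simp: sides_interval_iff sides_polygon_iff D_def)
  qed
  moreover have "diagonals {i..j} \<inter> D = {}"
  proof (rule ccontr)
    assume "diagonals {i..j} \<inter> D \<noteq> {}"
    then obtain e where e: "e \<in> diagonals {i..j}" "e \<in> D" by blast
    then obtain p q where "p < q" "e = {p, q}" "p \<in> {i..j}" "q \<in> {i..j}" by (elim diagonalsE)
    then show False using D_inside[of p q] e by (auto simp: diagonals_iff)
  qed
  moreover have "card {i..j} \<ge> 3" using r by (simp add: j_def)
  moreover have "{i..j} \<subseteq> polygon n" using j_le by (auto simp: polygon_def)
  ultimately show ?thesis by (simp add: cells_def)
qed

text \<open>Suppose the cell leaves \<open>{i..j}\<close>. Its outermost vertices within
  \<open>{i..j}\<close> must be \<open>i\<close> and \<open>j\<close>, for otherwise one of its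
  sides would cross \<open>{i, j}\<close>; but then the chord \<open>{i, j}\<close> would be a
  diagonal of the cell. So the cell stays in \<open>{i..j}\<close>, where the only available sides
  are unit steps and \<open>{i, j}\<close>.\<close>

lemma cell_inside:
  assumes C: "C \<in> cells n D" and c: "c \<in> C" "i < c" "c < j"
  shows "C = {i..j}"
proof -
  have C': "C \<subseteq> polygon n" "card C \<ge> 3" "sides C \<subseteq> sides (polygon n) \<union> D" "diagonals C \<inter> D = {}"
    using C by (auto simp: cells_def)
  have fin: "finite C" using C'(1) finite_subset by (auto simp: polygon_def)
  \<comment> \<open>Sides of the cell do not cross the chord \<open>{i, j}\<close>.\<close>
  have nc: "\<not> (p < i \<and> i < q \<and> q < j)" "\<not> (i < p \<and> p < j \<and> j < q)"
    if pq: "{p, q} \<in> sides C" "p < q" for p q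
  proof -
    have "{p, q} \<in> sides (polygon n) \<or> {p, q} \<in> D" using pq C'(3) by blast
    then show "\<not> (p < i \<and> i < q \<and> q < j)" "\<not> (i < p \<and> p < j \<and> j < q)"
      using D_not_inside[of "{p, q}"] pq(2) j_le by (auto simp: sides_polygon_iff)
  qed
  have sub: "C \<subseteq> {i..j}"
  proof (rule ccontr)
    assume "\<not> C \<subseteq> {i..j}"
    then obtain x where x: "x \<in> C" "x < i \<or> j < x" by fastforce
    let ?A = "C \<inter> {i..j}"
    have A: "finite ?A" "c \<in> ?A" using fin c by auto
    have "Min ?A \<in> ?A" "Max ?A \<in> ?A" using A Min_in Max_in by blast+
    moreover have "Min ?A \<le> c" "c \<le> Max ?A" using A by auto
    moreover have le: "Min ?A \<le> v" "v \<le> Max ?A" if "v \<in> C" "i \<le> v" "v \<le> j" for v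
      using A that by auto
    ultimately obtain p q where pq: "p \<in> C" "q \<in> C" "i \<le> p" "p \<le> c" "c \<le> q" "q \<le> j"
      and pqv: "\<And>v. v \<in> C \<Longrightarrow> i \<le> v \<Longrightarrow> v \<le> j \<Longrightarrow> p \<le> v \<and> v \<le> q"
      by auto
    have "p = i"
    proof (rule ccontr)
      assume "p \<noteq> i"
      then have p: "i < p" "p < j" using pq c by auto
      show False
      proof (cases "\<exists>y\<in>C. y < i")
        case True
        then obtain y where y: "y \<in> C" "y < i" by blast
        obtain v where v: "v < p" "y \<le> v" "{v, p} \<in> sides C" "v \<in> C"
          using side_pred[OF fin pq(1) y(1)] y p by auto
        then have "v < i" using pqv[of v] p by force
        then show False using nc(1)[OF v(3,1)] p by simp
      next
        case False
        then have x': "j < x" using x by auto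
        \<comment> \<open>Without vertices below \<open>i\<close>, the side of the cell that crosses
          the chord is the closing one, from \<open>p\<close> to a vertex beyond
          \<open>j\<close>.\<close>
        have "Min C = p"
          using fin pq False pqv by (intro Min_eqI) (metis le_cases not_le order_trans)+
        moreover have "x \<le> Max C" using fin x by simp
        moreover have "Min C < Max C" "{Min C, Max C} \<in> sides C"
          using side_Min_Max[OF fin pq(1) x(1)] p x' by auto
        ultimately show False using nc(2)[of "Min C" "Max C"] p x' by simp
      qed
    qed
    moreover have "q = j"
    proof (rule ccontr)
      assume "q \<noteq> j"
      then have q: "i < q" "q < j" using pq c by auto
      show False
      proof (cases "\<exists>y\<in>C. j < y")
        case True
        then obtain y where y: "y \<in> C" "j < y" by blast
        obtain v where v: "q < v" "v \<le> y" "{q, v} \<in> sides C" "v \<in> C"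
          using side_succ[OF fin pq(2) y(1)] y q by auto
        then have "j < v" using pqv[of v] q by force
        then show False using nc(2)[OF v(3,1)] q by simp
      next
        case False
        then have x': "x < i" using x by auto
        have "Max C = q"
          using fin pq False pqv by (intro Max_eqI) (metis le_cases not_le order_trans)+
        moreover have "Min C \<le> x" using fin x by simp
        moreover have "Min C < Max C" "{Min C, Max C} \<in> sides C"
          using side_Min_Max[OF fin x(1) pq(2)] q x' by auto
        ultimately show False using nc(1)[of "Min C" "Max C"] q x' by simp
      qed
    qed
    ultimately have "{i, j} \<in> diagonals C"
      using pq c x i_less_j by (auto simp: diagonals_iff)
    then show False using C'(4) by (auto simp: D_def)
  qed
  show ?thesis
  proof (rule interval_if_sides_short[OF C'(2)])
    fix p q assume pq: "p < q" "{p, q} \<in> sides C"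
    then have "i \<le> p" "q \<le> j" using sub by (auto simp: sides_iff)
    then show "q = Suc p \<or> p = i \<and> q = j"
      using pq C'(3) D_inside[of p q] ij_not_outer j_le by (auto simp: sides_polygon_iff)
  qed
qed

lemma cells_ear: "cells n D = insert {i..j} ((`) f ` cells n' D')"
proof (intro set_eqI iffI)
  fix C assume C: "C \<in> cells n D"
  show "C \<in> insert {i..j} ((`) f ` cells n' D')"
  proof (cases "C \<inter> {i<..<j} = {}")
    case False
    then show ?thesis using cell_inside[OF C] by auto
  next
    case True
    then have "C \<subseteq> f ` polygon n'" using C unfolding f_polygon cells_def by blast
    then obtain C' where "C' \<subseteq> polygon n'" "C = f ` C'" by (auto simp: subset_image_iff)
    then show ?thesis using C f_cell_iff by auto
  qed
next
  fix C assume "C \<in> insert {i..j} ((`) f ` cells n' D')"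
  moreover have "C' \<subseteq> polygon n'" if "C' \<in> cells n' D'" for C' using that by (simp add: cells_def)
  ultimately show "C \<in> cells n D" using ear_cell f_cell_iff by blast
qed

lemma ear_cell_new: "{i..j} \<notin> (`) f ` cells n' D'"
proof
  assume "{i..j} \<in> (`) f ` cells n' D'"
  then obtain C where "{i..j} = f ` C" by blast
  moreover have "Suc i \<in> {i..j}" "Suc i \<in> {i<..<j}" using r by (auto simp: j_def)
  ultimately show False using f_not_inside by (metis imageE)
qed

lemma inj_on_image_cells: "inj_on ((`) f) A"
  using inj_f by (intro inj_onI) (metis inj_image_eq_iff)

lemma finite_cells: "finite (cells n' D')"
  by (rule finite_subset[of _ "Pow (polygon n')"]) (auto simp: cells_def polygon_def)

lemma card_cells_ear: "card (cells n D) = Suc (card (cells n' D'))"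
  unfolding cells_ear using ear_cell_new finite_cells inj_on_image_cells
  by (simp add: card_image)

lemma three_periodic_ear: "three_periodic n D \<longleftrightarrow> 3 dvd (r + 2) \<and> three_periodic n' D'"
proof -
  have "card (f ` C) = card C" for C using inj_f by (simp add: card_image inj_on_subset)
  then show ?thesis unfolding three_periodic_def cells_ear by (simp add: j_def)
qed

lemma count_f:
  "card {C \<in> cells n D. f u \<in> C} = card {C \<in> cells n' D'. u \<in> C} + (if u = i \<or> u = Suc i then 1 else 0)"
proof -
  have fu: "f u \<in> {i..j} \<longleftrightarrow> u = i \<or> u = Suc i" by (auto simp: f_def j_def)
  have mem: "f u \<in> f ` C \<longleftrightarrow> u \<in> C" for C using inj_f by (rule inj_image_mem_iff)
  have img: "{C \<in> (`) f ` cells n' D'. f u \<in> C} = (`) f ` {C \<in> cells n' D'. u \<in> C}"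
    using mem by blast
  define c where "c \<longleftrightarrow> u = i \<or> u = Suc i"
  let ?A = "(`) f ` {C \<in> cells n' D'. u \<in> C}"
  have "{C \<in> cells n D. f u \<in> C} = (if c then {{i..j}} else {}) \<union> ?A"
    unfolding cells_ear img[symmetric] fu[symmetric] c_def by auto
  moreover have "{i..j} \<notin> ?A" "finite ?A" using ear_cell_new finite_cells by auto
  moreover have "card ?A = card {C \<in> cells n' D'. u \<in> C}"
    by (rule card_image) (rule inj_on_image_cells)
  ultimately show ?thesis unfolding c_def[symmetric] by (cases c) simp_all
qed

lemma count_inside:
  assumes "i < v" "v < j"
  shows "card {C \<in> cells n D. v \<in> C} = 1"
proof -
  have "v \<notin> f ` C" for C using assms f_not_inside by (metis greaterThanLessThan_iff imageE)
  then have "{C \<in> cells n D. v \<in> C} = {{i..j}}" unfolding cells_ear using assms by auto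
  then show ?thesis by simp
qed

lemma quiddity_ear:
  assumes q: "quiddity n' D' = xs @ [a, b] @ ys" and xs: "length xs = i"
  shows "quiddity n D = xs @ [Suc a] @ replicate r 1 @ [Suc b] @ ys"
proof (rule nth_equalityI)
  have len: "length ys + i = n'" using arg_cong[OF q, of length] xs by (simp add: quiddity_def)
  then show "length (quiddity n D) = length (xs @ [Suc a] @ replicate r 1 @ [Suc b] @ ys)"
    using xs by (simp add: quiddity_def n_def)
  have old: "card {C \<in> cells n' D'. u \<in> C} = (xs @ [a, b] @ ys) ! u" if "u < n' + 2" for u
    using arg_cong[OF q, of "\<lambda>l. l ! u"] that by (simp add: quiddity_def del: upt_Suc)
  fix k assume "k < length (quiddity n D)"
  then have k: "k < n + 2" by (simp add: quiddity_def)
  then have nth: "quiddity n D ! k = card {C \<in> cells n D. k \<in> C}"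
    by (simp add: quiddity_def del: upt_Suc)
  show "quiddity n D ! k = (xs @ [Suc a] @ replicate r 1 @ [Suc b] @ ys) ! k"
  proof (cases "i < k \<and> k < j")
    case True
    then have "k - i \<noteq> 0" "k - Suc i < r" by (auto simp: j_def)
    then show ?thesis unfolding nth using True count_inside xs by (auto simp: nth_append nth_Cons')
  next
    case False
    \<comment> \<open>\<open>u\<close> is the old vertex that is relabelled to
      \<open>k\<close>.\<close>
    define u where "u = (if k \<le> i then k else k - r)"
    have u: "k = f u" "u < n' + 2" using False k i by (auto simp: u_def f_def j_def n_def)
    have "quiddity n D ! k = (xs @ [a, b] @ ys) ! u + (if u = i \<or> u = Suc i then 1 else 0)"
      using nth count_f[of u] old[OF u(2)] u(1) by simp
    also have "\<dots> = (xs @ [Suc a] @ replicate r 1 @ [Suc b] @ ys) ! k"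
    proof (cases "k \<le> i")
      case True
      then show ?thesis using xs by (auto simp: u_def nth_append nth_Cons')
    next
      case kF: False
      then obtain t where t: "k = i + r + 1 + t" using False by (metis j_def le_iff_add not_le)
      then have "u = i + 1 + t" using kF by (simp add: u_def)
      then show ?thesis using xs t by (cases t) (auto simp: nth_append)
    qed
    finally show ?thesis .
  qed
qed

lemma D_subset: "D \<subseteq> diagonals (polygon n)"
proof
  fix e assume "e \<in> D"
  then consider "e = {i, j}" | e' where "e' \<in> D'" "e = f ` e'" unfolding D_def by blast
  then show "e \<in> diagonals (polygon n)"
  proof cases
    case 1
    have "j \<noteq> Suc i" using r by (simp add: j_def)
    then show ?thesis using 1 ij_not_outer j_le diagonals_polygon_iff[OF i_less_j] by simp
  next
    case 2
    then obtain p q where pq: "p < q" "q \<le> n' + 1" "e' = {p, q}" "{p, q} \<notin> sides (polygon n')"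
      using D'_pair by blast
    have "{f p, f q} \<notin> sides (polygon n)" using sides_polygon_f_iff pq by blast
    moreover have "f p < f q" using f_mono pq by (simp add: strict_mono_less)
    moreover have "f p \<in> polygon n" "f q \<in> polygon n"
      using f_polygon pq by (auto simp: polygon_def)
    ultimately show ?thesis using pq 2 unfolding diagonals_def by auto
  qed
qed

lemma not_crossing_ij:
  assumes "e \<inter> {i<..<j} = {}"
  shows "\<not> crossing {i, j} e" "\<not> crossing e {i, j}"
proof -
  have False if "p < k" "k < q" "q < l" "({i, j} = {p, q} \<and> e = {k, l}) \<or> (e = {p, q} \<and> {i, j} = {k, l})"
    for p q k l
    using that assms i_less_j by (auto simp: doubleton_eq_iff)
  then show "\<not> crossing {i, j} e" "\<not> crossing e {i, j}" unfolding crossing_def by metis+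
qed

lemma dissection_ear: "dissection n D \<longleftrightarrow> dissection n' D'"
proof -
  have "(\<forall>d\<in>D. \<forall>e\<in>D. \<not> crossing d e) \<longleftrightarrow> (\<forall>d\<in>D'. \<forall>e\<in>D'. \<not> crossing d e)"
  proof -
    have "\<not> crossing {i, j} e" "\<not> crossing e {i, j}" if "e \<in> D" for e
      using not_crossing_ij D_not_inside[OF that] by auto
    then have "(\<forall>d\<in>D. \<forall>e\<in>D. \<not> crossing d e) \<longleftrightarrow>
        (\<forall>d\<in>(`) f ` D'. \<forall>e\<in>(`) f ` D'. \<not> crossing d e)"
      unfolding D_def by blast
    then show ?thesis by (simp add: crossing_image_iff[OF f_mono])
  qed
  then show ?thesis using D_subset D' by (simp add: dissection_def)
qed

end

text \<open>A shortest chord cuts off a cell.\<close>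

lemma dissection_ear_decomposition:
  assumes dis: "dissection n D" and ne: "D \<noteq> {}"
  obtains n' i r D' where "ear n' i r D'" "n = ear.n n' r" "D = ear.D i r D'"
proof -
  have pair: "\<exists>p q. p < q \<and> e = {p, q} \<and> q \<le> n + 1 \<and> q \<noteq> Suc p \<and> \<not> (p = 0 \<and> q = n + 1)"
    if "e \<in> D" for e
  proof -
    have e: "e \<in> diagonals (polygon n)" using that dis by (auto simp: dissection_def)
    then obtain p q where "p < q" "e = {p, q}" "p \<in> polygon n" "q \<in> polygon n" by (rule diagonalsE)
    then show ?thesis using e diagonals_polygon_iff[of p q n] by blast
  qed
  define P where "P = (\<lambda>(p, q). p < q \<and> {p, q} \<in> D)"
  have "\<exists>x. P x" using ne pair unfolding P_def by fastforce
  then obtain x where x: "P x" "\<And>y. P y \<Longrightarrow> snd x - fst x \<le> snd y - fst y"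
    using ex_has_least_nat[of P _ "\<lambda>y. snd y - fst y"] by blast
  obtain i j where ij_x: "x = (i, j)" by (cases x)
  have ij: "i < j" "{i, j} \<in> D" using x(1) ij_x by (auto simp: P_def)
  have least: "j - i \<le> q - p" if "p < q" "{p, q} \<in> D" for p q
    using x(2)[of "(p, q)"] that ij_x by (simp add: P_def)
  have ij': "j \<le> n + 1" "j \<noteq> Suc i" "\<not> (i = 0 \<and> j = n + 1)"
    using pair[OF ij(2)] ij(1) by (auto simp: doubleton_eq_iff)
  define r where "r = j - i - 1"
  define n' where "n' = n - r"
  define f :: "nat \<Rightarrow> nat" where "f v = (if v \<le> i then v else v + r)" for v
  \<comment> \<open>The remaining chords, pulled back to the polygon without the ear.\<close>
  define D' where "D' = {e. e \<subseteq> polygon n' \<and> f ` e \<in> D - {{i, j}}}"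
  have r: "r \<ge> 1" "j = i + r + 1" using ij ij' by (auto simp: r_def)
  have n': "n' \<ge> 1" "n = n' + r" "i \<le> n'" using ij' r by (auto simp: n'_def)
  have "D' \<subseteq> diagonals (polygon n')"
  proof
    fix e assume "e \<in> D'"
    then have e: "e \<subseteq> polygon n'" "f ` e \<in> D" "f ` e \<noteq> {i, j}" by (auto simp: D'_def)
    have sm: "strict_mono f" by (auto simp: strict_mono_def f_def)
    obtain p q where pq: "p < q" "f ` e = {p, q}" "q \<le> n + 1" "q \<noteq> Suc p" "\<not> (p = 0 \<and> q = n + 1)"
      using pair[OF e(2)] by blast
    obtain p' q' where pq': "e = {p', q'}" "f p' = p" "f q' = q"
      using strict_mono_pair_image[OF sm pq(2)] .
    have less: "p' < q'" using pq pq' sm strict_mono_less by blast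
    \<comment> \<open>The only non-side of the large polygon whose preimage would be a side is
      \<open>{i, j}\<close> itself.\<close>
    have "\<not> (p = i \<and> q = j)" using e(3) pq(2) by blast
    then have "{p', q'} \<notin> sides (polygon n')"
      using less pq pq' n' r by (auto simp: sides_polygon_iff f_def split: if_splits)
    then show "e \<in> diagonals (polygon n')" using e(1) pq' less unfolding diagonals_def by blast
  qed
  then interpret E: ear n' i r D' using n' r by unfold_locales auto
  have [simp]: "ear.n n' r = n" "ear.j i r = j" "ear.f i r = f"
    by (auto simp: E.n_def n'(2) E.j_def r(2) E.f_def f_def)
  have "D \<subseteq> insert {i, j} ((`) f ` D')"
  proof
    fix e assume e: "e \<in> D"
    show "e \<in> insert {i, j} ((`) f ` D')"
    proof (cases "e = {i, j}")
      case False
      obtain p q where pq: "p < q" "e = {p, q}" "q \<le> n + 1" using pair[OF e] by blast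
      have nc: "\<not> crossing {i, j} e" "\<not> crossing e {i, j}"
        using dis e ij(2) by (auto simp: dissection_def)
      have l: "j - i \<le> q - p" using least pq e by blast
      have "\<not> (i < p \<and> p < j \<and> j < q)" using nc(1) pq(2) unfolding crossing_def by blast
      moreover have "\<not> (p < i \<and> i < q \<and> q < j)" using nc(2) pq(2) unfolding crossing_def by blast
      \<comment> \<open>A chord with an end strictly between \<open>i\<close> and \<open>j\<close>
        that does not cross \<open>{i, j}\<close> would run within \<open>{i..j}\<close> and be
        shorter than the shortest chord.\<close>
      ultimately have "p \<notin> {i<..<j}" "q \<notin> {i<..<j}" using l pq(1) by auto
      then have "e \<subseteq> polygon n - {i<..<j}" using pq by (auto simp: polygon_def)
      then have "e \<subseteq> f ` polygon n'" using E.f_polygon by simp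
      then obtain e' where "e' \<subseteq> polygon n'" "e = f ` e'" by (auto simp: subset_image_iff)
      then show ?thesis using e False by (auto simp: D'_def)
    qed simp
  qed
  moreover have "insert {i, j} ((`) f ` D') \<subseteq> D" using ij by (auto simp: D'_def)
  ultimately have "D = ear.D i r D'" using E.D_def by simp
  then show ?thesis using that E.ear_axioms by simp
qed

section \<open>Quiddities of dissections are exactly the ear quiddities\<close>

lemma quiddity_empty:
  assumes "n \<ge> 1"
  shows "quiddity n {} = replicate (n + 2) 1"
proof (rule nth_equalityI)
  fix k assume "k < length (quiddity n {})"
  then have k: "k < n + 2" by (simp add: quiddity_def)
  then have "{C \<in> cells n {}. k \<in> C} = {polygon n}"
    using cells_empty[OF assms] by (auto simp: polygon_def)
  then show "quiddity n {} ! k = replicate (n + 2) 1 ! k"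
    using k by (simp add: quiddity_def del: upt_Suc replicate_Suc)
qed (simp add: quiddity_def)

text \<open>Cutting off an ear lowers the number of cells by one and keeps the smaller dissection
  3-periodic; \<open>3 dvd r + 2\<close> gives the number of new vertices its form
  \<open>3 * k + 1\<close>.\<close>

lemma quiddity_imp_ear_quiddity:
  assumes "n \<ge> 1" "dissection n D" "three_periodic n D"
  shows "ear_quiddity (card (cells n D)) (quiddity n D)"
  using assms
proof (induction "card (cells n D)" arbitrary: n D rule: less_induct)
  case less
  show ?case
  proof (cases "D = {}")
    case True
    have "3 dvd n + 2"
      using less.prems True cells_empty by (simp add: three_periodic_def polygon_def)
    then obtain k where "n + 2 = 3 * k" by blast
    then have "n + 2 = 3 * (k - 1) + 3" by (cases k) auto
    then have "quiddity n {} = replicate (3 * (k - 1) + 3) 1"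
      by (simp only: quiddity_empty[OF less.prems(1)])
    moreover have "card (cells n {}) = 1" using cells_empty[OF less.prems(1)] by simp
    ultimately show ?thesis unfolding True by (metis ear_quiddity_cell)
  next
    case False
    obtain n' i r D' where ear: "ear n' i r D'" and n: "n = ear.n n' r" and D: "D = ear.D i r D'"
      using dissection_ear_decomposition[OF less.prems(2) False] .
    interpret ear n' i r D' by (rule ear)
    have len: "length (quiddity n' D') = n' + 2" by (simp add: quiddity_def)
    obtain xs a b ys where q: "quiddity n' D' = xs @ [a, b] @ ys" "length xs = i"
    proof -
      let ?q = "quiddity n' D'"
      have "?q = take i ?q @ [?q ! i, ?q ! Suc i] @ drop (i + 2) ?q"
        using len i by (simp add: Cons_nth_drop_Suc)
      then show ?thesis using that[of "take i ?q"] len i by simp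
    qed
    have "3 dvd r + 2" "three_periodic n' D'" "dissection n' D'"
      using less.prems n D three_periodic_ear dissection_ear by auto
    then have "ear_quiddity (card (cells n' D')) (xs @ [a, b] @ ys)"
      using less.hyps[of n' D'] n' card_cells_ear n D q by simp
    moreover obtain k where "r = 3 * k + 1"
    proof -
      obtain l where l: "r + 2 = 3 * l" using \<open>3 dvd r + 2\<close> by blast
      then have "r = 3 * (l - 1) + 1" by (cases l) auto
      then show ?thesis using that by blast
    qed
    ultimately show ?thesis
      using ear_quiddity_ear[of "card (cells n' D')" xs a b ys k] quiddity_ear[OF q] card_cells_ear n D by simp
  qed
qed

lemma ear_quiddity_imp_quiddity:
  assumes "ear_quiddity m a"
  shows "\<exists>n D. n \<ge> 1 \<and> dissection n D \<and> three_periodic n D \<and> card (cells n D) = m \<and> quiddity n D = a"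
  using assms
proof (induction rule: ear_quiddity.induct)
  case (ear_quiddity_cell k)
  let ?n = "3 * k + 1"
  have "card (polygon ?n) = 3 * (k + 1)" by (simp add: polygon_def)
  then have "three_periodic ?n {}" by (simp add: three_periodic_def cells_empty del: card_atLeastAtMost)
  moreover have "dissection ?n {}" by (simp add: dissection_def)
  moreover have "quiddity ?n {} = replicate (3 * k + 3) 1" using quiddity_empty[of ?n] by (simp add: numeral_3_eq_3)
  ultimately show ?case
    by (intro exI[of _ ?n] exI[of _ "{}"]) (simp add: cells_empty)
next
  case (ear_quiddity_ear m xs a b ys k)
  then obtain n' D' where IH: "n' \<ge> 1" "dissection n' D'" "three_periodic n' D'"
    "card (cells n' D') = m" "quiddity n' D' = xs @ [a, b] @ ys" by blast
  have "length xs \<le> n'" using arg_cong[OF IH(5), of length] by (simp add: quiddity_def)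
  define r where "r = 3 * k + 1"
  interpret ear n' "length xs" r D'
    using IH(1,2) \<open>length xs \<le> n'\<close> by unfold_locales (auto simp: dissection_def r_def)
  have "3 dvd r + 2" unfolding r_def by presburger
  then have "three_periodic n D" using three_periodic_ear IH(3) by blast
  moreover have "n \<ge> 1" using IH(1) by (simp add: n_def)
  moreover have "dissection n D" "card (cells n D) = Suc m"
    using dissection_ear card_cells_ear IH by auto
  moreover have "quiddity n D = xs @ [Suc a] @ replicate (3 * k + 1) 1 @ [Suc b] @ ys"
    unfolding r_def[symmetric] using quiddity_ear[OF IH(5)] by simp
  ultimately show ?case by blast
qed

lemma quiddities_eq:
  assumes "n \<ge> 1"
  shows "{quiddity n D |D. dissection n D \<and> three_periodic n D \<and> card (cells n D) = m}
       = {a. ear_quiddity m a \<and> length a = n + 2}"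
proof (intro set_eqI iffI)
  fix a assume "a \<in> {quiddity n D |D. dissection n D \<and> three_periodic n D \<and> card (cells n D) = m}"
  then show "a \<in> {a. ear_quiddity m a \<and> length a = n + 2}"
    using quiddity_imp_ear_quiddity[OF assms] by (auto simp: quiddity_def)
next
  fix a assume "a \<in> {a. ear_quiddity m a \<and> length a = n + 2}"
  then obtain n' D where D: "dissection n' D" "three_periodic n' D" "card (cells n' D) = m"
    "quiddity n' D = a" "length a = n + 2" using ear_quiddity_imp_quiddity by blast
  then have "n' = n" by (auto simp: quiddity_def)
  then show "a \<in> {quiddity n D |D. dissection n D \<and> three_periodic n D \<and> card (cells n D) = m}"
    using D by blast
qed

section \<open>Generating functions\<close>

unbundle fps_syntax

text \<open>An infinite weight class would be counted as 0 by \<open>card\<close>; the rules for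
  unions and products therefore assume \<open>finite_weights\<close>.\<close>

definition weight_gf :: "('a \<Rightarrow> nat) \<Rightarrow> ('a \<Rightarrow> nat) \<Rightarrow> 'a set \<Rightarrow> rat fps fps" where
  "weight_gf u v A = Abs_fps (\<lambda>n. Abs_fps (\<lambda>m. of_nat (card {x \<in> A. u x = n \<and> v x = m})))"

definition finite_weights :: "('a \<Rightarrow> nat) \<Rightarrow> ('a \<Rightarrow> nat) \<Rightarrow> 'a set \<Rightarrow> bool" where
  "finite_weights u v A \<longleftrightarrow> (\<forall>n m. finite {x \<in> A. u x = n \<and> v x = m})"

lemma weight_gf_cong:
  assumes "\<And>x. x \<in> A \<Longrightarrow> u x = u' x" "\<And>x. x \<in> A \<Longrightarrow> v x = v' x"
  shows "weight_gf u v A = weight_gf u' v' A"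
proof -
  have "{x \<in> A. u x = n \<and> v x = m} = {x \<in> A. u' x = n \<and> v' x = m}" for n m using assms by auto
  then show ?thesis by (simp add: weight_gf_def)
qed

lemma weight_gf_image:
  assumes "inj_on g A"
  shows "weight_gf u v (g ` A) = weight_gf (u \<circ> g) (v \<circ> g) A"
proof -
  have "{x \<in> g ` A. u x = n \<and> v x = m} = g ` {x \<in> A. u (g x) = n \<and> v (g x) = m}" for n m by auto
  moreover have "inj_on g {x \<in> A. u (g x) = n \<and> v (g x) = m}" for n m
    using assms by (rule inj_on_subset) auto
  ultimately show ?thesis by (simp add: weight_gf_def card_image)
qed

lemma weight_gf_union:
  assumes "finite_weights u v A" "finite_weights u v B" "A \<inter> B = {}"
  shows "weight_gf u v (A \<union> B) = weight_gf u v A + weight_gf u v B"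
proof (intro fps_ext)
  fix n m
  let ?S = "\<lambda>A. {x \<in> A. u x = n \<and> v x = m}"
  have "?S (A \<union> B) = ?S A \<union> ?S B" "?S A \<inter> ?S B = {}" using assms(3) by auto
  moreover have "finite (?S A)" "finite (?S B)" using assms by (auto simp: finite_weights_def)
  ultimately show "weight_gf u v (A \<union> B) $ n $ m = (weight_gf u v A + weight_gf u v B) $ n $ m"
    by (simp add: weight_gf_def card_Un_disjoint)
qed

lemma weight_gf_Times:
  assumes "finite_weights u v A" "finite_weights u' v' B"
  shows "weight_gf (\<lambda>(x, y). u x + u' y) (\<lambda>(x, y). v x + v' y) (A \<times> B)
       = weight_gf u v A * weight_gf u' v' B"
proof (intro fps_ext)
  fix n m
  define a where "a i j = {x \<in> A. u x = i \<and> v x = j}" for i j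
  define b where "b i j = {y \<in> B. u' y = i \<and> v' y = j}" for i j
  have fin: "finite (a i j)" "finite (b i j)" for i j
    using assms by (auto simp: finite_weights_def a_def b_def)
  have "{z \<in> A \<times> B. (case z of (x, y) \<Rightarrow> u x + u' y) = n \<and> (case z of (x, y) \<Rightarrow> v x + v' y) = m}
      = (\<Union>(i, j)\<in>{0..n} \<times> {0..m}. a i j \<times> b (n - i) (m - j))"
    by (auto simp: a_def b_def)
  also have "card \<dots> = (\<Sum>(i, j)\<in>{0..n} \<times> {0..m}. card (a i j \<times> b (n - i) (m - j)))"
    unfolding case_prod_unfold
    by (rule card_UN_disjoint) (use fin in \<open>auto simp: a_def b_def\<close>)
  also have "\<dots> = (\<Sum>i=0..n. \<Sum>j=0..m. card (a i j) * card (b (n - i) (m - j)))"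
    by (simp add: sum.cartesian_product card_cartesian_product)
  finally show "weight_gf (\<lambda>(x, y). u x + u' y) (\<lambda>(x, y). v x + v' y) (A \<times> B) $ n $ m
      = (weight_gf u v A * weight_gf u' v' B) $ n $ m"
    by (simp add: weight_gf_def fps_mult_nth fps_sum_nth flip: a_def b_def)
qed

lemma finite_weights_Times:
  assumes "finite_weights u v A" "finite_weights u' v' B"
  shows "finite_weights (\<lambda>(x, y). u x + u' y) (\<lambda>(x, y). v x + v' y) (A \<times> B)"
  unfolding finite_weights_def
proof (intro allI)
  fix n m
  have "{z \<in> A \<times> B. (case z of (x, y) \<Rightarrow> u x + u' y) = n \<and> (case z of (x, y) \<Rightarrow> v x + v' y) = m}
      \<subseteq> (\<Union>i\<in>{..n}. \<Union>j\<in>{..m}. {x \<in> A. u x = i \<and> v x = j}) \<times>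
        (\<Union>i\<in>{..n}. \<Union>j\<in>{..m}. {x \<in> B. u' x = i \<and> v' x = j})"
    by auto
  then show "finite {z \<in> A \<times> B. (case z of (x, y) \<Rightarrow> u x + u' y) = n \<and> (case z of (x, y) \<Rightarrow> v x + v' y) = m}"
    by (rule finite_subset) (use assms in \<open>auto simp: finite_weights_def\<close>)
qed

lemma weight_gf_shift:
  "weight_gf (\<lambda>x. u x + a) (\<lambda>x. v x + b) A = Z ^ a * W ^ b * weight_gf u v A"
proof (intro fps_ext)
  fix n m
  have "(Z ^ a * W ^ b * weight_gf u v A) $ n $ m =
      (if n < a \<or> m < b then 0 else of_nat (card {x \<in> A. u x = n - a \<and> v x = m - b}))"
    by (simp add: fps_const_power fps_X_power_mult_nth weight_gf_def mult.assoc)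
  moreover have "{x \<in> A. u x + a = n \<and> v x + b = m} =
      (if n < a \<or> m < b then {} else {x \<in> A. u x = n - a \<and> v x = m - b})" by auto
  ultimately show "weight_gf (\<lambda>x. u x + a) (\<lambda>x. v x + b) A $ n $ m =
      (Z ^ a * W ^ b * weight_gf u v A) $ n $ m"
    by (simp add: weight_gf_def)
qed

text \<open>
  A dissection into \<open>m\<close> cells of the \<open>(n+2)\<close>-gon has a quiddity with entry sum \<open>n + 2 m\<close>, so its word has
  \<open>n + 2 m\<close> letters \<open>U\<close> and \<open>2 m - 2\<close> letters \<open>S\<close>: its excess is \<open>n + 2\<close> and it has \<open>m - 1\<close> nodes.
\<close>

definition excess :: "letter list \<Rightarrow> nat" where
  "excess w = count_list w U - count_list w S"

definition nodes :: "letter list \<Rightarrow> nat" where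
  "nodes w = count_list w S div 2"

lemma finite_weights_words: "finite_weights excess nodes L"
  unfolding finite_weights_def
proof (intro allI)
  fix n m
  have len: "length w = count_list w U + count_list w S" for w
  proof (induction w)
    case (Cons l w) then show ?case by (cases l) auto
  qed simp
  have "UNIV = {U, S}" using letter.exhaust by auto
  then have "finite (UNIV :: letter set)" by (metis finite.emptyI finite.insertI)
  \<comment> \<open>With \<open>m\<close> nodes there are at most \<open>2 * m + 1\<close> letters
    \<open>S\<close>, and excess \<open>n\<close> then allows at most \<open>n + 2 * m + 1\<close>
    letters \<open>U\<close>.\<close>
  then have "finite {w :: letter list. set w \<subseteq> UNIV \<and> length w \<le> n + 4 * m + 2}"
    by (rule finite_lists_length_le)
  moreover have "{w \<in> L. excess w = n \<and> nodes w = m} \<subseteq> {w. set w \<subseteq> UNIV \<and> length w \<le> n + 4 * m + 2}"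
    using len by (auto simp: excess_def nodes_def)
  ultimately show "finite {w \<in> L. excess w = n \<and> nodes w = m}" by (rule rev_finite_subset)
qed

abbreviation word_gf :: "(letter list \<Rightarrow> bool) \<Rightarrow> rat fps fps" where
  "word_gf L \<equiv> weight_gf excess nodes (Collect L)"

section \<open>Translating the grammar into equations\<close>

lemma
  gap_word_counts: "gap_word p \<Longrightarrow> count_list p S \<le> count_list p U \<and> even (count_list p S)" and
  cell_word_counts: "cell_word a \<Longrightarrow> count_list a S + 3 \<le> count_list a U \<and> even (count_list a S)"
  by (induction rule: gap_word_cell_word.inducts) auto

lemma root_word_counts: "root_word a \<Longrightarrow> count_list a S + 3 \<le> count_list a U \<and> even (count_list a S)"
proof (induction rule: root_word.induct)
  case (root_word_single p q)
  then show ?case using gap_word_counts[of p] gap_word_counts[of q] by simp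
next
  case (root_word_append p q r a)
  then show ?case using gap_word_counts[of p] gap_word_counts[of q] gap_word_counts[of r] by simp
qed

text \<open>On such words neither the truncated subtraction in \<open>excess\<close> nor the
  division in \<open>nodes\<close> loses anything, so both weights are additive.\<close>

definition balanced :: "letter list \<Rightarrow> bool" where
  "balanced w \<longleftrightarrow> count_list w S \<le> count_list w U \<and> even (count_list w S)"

lemma balanced_words: "gap_word w \<Longrightarrow> balanced w" "cell_word w \<Longrightarrow> balanced w" "root_word w \<Longrightarrow> balanced w"
  using gap_word_counts[of w] cell_word_counts[of w] root_word_counts[of w] by (auto simp: balanced_def)

lemma balanced_simps:
  "balanced []" "balanced w \<Longrightarrow> balanced (U # w)" "balanced x \<Longrightarrow> balanced y \<Longrightarrow> balanced (x @ y)"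
  by (auto simp: balanced_def)

lemma weights_simps:
  "excess [] = 0" "nodes [] = 0"
  "balanced w \<Longrightarrow> excess (U # w) = Suc (excess w)" "nodes (U # w) = nodes w"
  "balanced x \<Longrightarrow> balanced y \<Longrightarrow> excess (x @ y) = excess x + excess y"
  "balanced x \<Longrightarrow> nodes (x @ y) = nodes x + nodes y"
  by (auto simp: excess_def nodes_def balanced_def elim!: evenE)

lemma block_unique:
  assumes "gap_word p" "gap_word q" "gap_word p'" "gap_word q'" "U # p @ U # q @ U # x = U # p' @ U # q' @ U # y"
  shows "p = p' \<and> q = q' \<and> x = y"
proof -
  have "p @ U # (q @ U # x) = p' @ U # (q' @ U # y)" using assms(5) by simp
  then have p: "p = p'" using gap_word_prefix_unique assms by blast
  then have "q @ U # x = q' @ U # y" using assms(5) by simp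
  then show ?thesis using gap_word_prefix_unique assms p by blast
qed

lemma weight_gf_block:
  "weight_gf excess nodes ((\<lambda>(p, q). U # p @ U # q @ [U]) ` (Collect gap_word \<times> Collect gap_word)) = Z ^ 3 * word_gf gap_word ^ 2"
proof -
  let ?g = "\<lambda>(p, q). U # p @ U # q @ [U]" and ?A = "Collect gap_word \<times> Collect gap_word"
  have inj: "inj_on ?g ?A"
    using block_unique[where x = "[]" and y = "[]"] by (auto intro!: inj_onI)
  have "weight_gf excess nodes (?g ` ?A) = weight_gf (excess \<circ> ?g) (nodes \<circ> ?g) ?A"
    by (rule weight_gf_image[OF inj])
  also have "\<dots> = weight_gf (\<lambda>x. (case x of (p, q) \<Rightarrow> excess p + excess q) + 3)
      (\<lambda>x. (case x of (p, q) \<Rightarrow> nodes p + nodes q) + 0) ?A"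
    by (rule weight_gf_cong) (auto simp: balanced_words balanced_simps weights_simps)
  also have "\<dots> = Z ^ 3 * W ^ 0 * (word_gf gap_word * word_gf gap_word)"
    unfolding weight_gf_shift by (simp add: weight_gf_Times finite_weights_words)
  finally show ?thesis by (simp add: power2_eq_square)
qed

text \<open>The two summands are the two rules. By \<open>block_unique\<close> they yield disjoint
  sets of words, and each word determines its components. The three letters \<open>U\<close> give
  \<open>Z ^ 3\<close>.\<close>

lemma gf_cell_word: "word_gf cell_word = Z ^ 3 * word_gf gap_word ^ 2 + Z ^ 3 * word_gf gap_word ^ 2 * word_gf cell_word"
proof -
  let ?g = "\<lambda>(p, q). U # p @ U # q @ [U]" and ?A = "Collect gap_word \<times> Collect gap_word"
  let ?h = "\<lambda>(p, q, a). U # p @ U # q @ U # a" and ?B = "Collect gap_word \<times> Collect gap_word \<times> Collect cell_word"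
  have eq: "Collect cell_word = ?g ` ?A \<union> ?h ` ?B"
  proof (intro set_eqI iffI)
    fix w assume "w \<in> Collect cell_word"
    then have "cell_word w" by simp
    then show "w \<in> ?g ` ?A \<union> ?h ` ?B" by cases force+
  next
    fix w assume "w \<in> ?g ` ?A \<union> ?h ` ?B"
    then show "w \<in> Collect cell_word" using cell_word_single cell_word_append by auto
  qed
  have disj: "?g ` ?A \<inter> ?h ` ?B = {}"
  proof (rule ccontr)
    assume "?g ` ?A \<inter> ?h ` ?B \<noteq> {}"
    then obtain p q p' q' a where h: "gap_word p" "gap_word q" "gap_word p'" "gap_word q'" "cell_word a"
      "U # p @ U # q @ U # [] = U # p' @ U # q' @ U # a" by auto
    from block_unique[OF h(1-4,6)] have "a = []" by simp
    then show False using cell_word_start[OF h(5)] by simp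
  qed
  have inj: "inj_on ?h ?B"
  proof (rule inj_onI, clarsimp)
    fix p q a p' q' a'
    assume "gap_word p" "gap_word q" "cell_word a" "gap_word p'" "gap_word q'" "cell_word a'" "p @ U # q @ U # a = p' @ U # q' @ U # a'"
    then show "p = p' \<and> q = q' \<and> a = a'" by (intro block_unique) auto
  qed
  have "weight_gf excess nodes (?h ` ?B) = weight_gf (excess \<circ> ?h) (nodes \<circ> ?h) ?B"
    by (rule weight_gf_image[OF inj])
  also have "\<dots> = weight_gf (\<lambda>x. (case x of (p, y) \<Rightarrow> excess p + (case y of (q, a) \<Rightarrow> excess q + excess a)) + 3)
      (\<lambda>x. (case x of (p, y) \<Rightarrow> nodes p + (case y of (q, a) \<Rightarrow> nodes q + nodes a)) + 0) ?B"
    by (rule weight_gf_cong) (auto simp: balanced_words balanced_simps weights_simps)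
  also have "\<dots> = Z ^ 3 * W ^ 0 * (word_gf gap_word * (word_gf gap_word * word_gf cell_word))"
    unfolding weight_gf_shift
    by (simp add: weight_gf_Times finite_weights_words finite_weights_Times)
  finally have "weight_gf excess nodes (?h ` ?B) = Z ^ 3 * word_gf gap_word ^ 2 * word_gf cell_word"
    by (simp add: power2_eq_square)
  then show ?thesis
    using weight_gf_union[OF finite_weights_words finite_weights_words disj] weight_gf_block
    unfolding eq[symmetric] by simp
qed

lemma gf_root_word: "word_gf root_word = Z ^ 3 * word_gf gap_word ^ 2 + Z ^ 3 * word_gf gap_word ^ 3 * word_gf root_word"
proof -
  let ?g = "\<lambda>(p, q). U # p @ U # q @ [U]" and ?A = "Collect gap_word \<times> Collect gap_word"
  let ?h = "\<lambda>(p, q, r, a). U # p @ U # q @ U # r @ a"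
    and ?B = "Collect gap_word \<times> Collect gap_word \<times> Collect gap_word \<times> Collect root_word"
  have eq: "Collect root_word = ?g ` ?A \<union> ?h ` ?B"
  proof (intro set_eqI iffI)
    fix w assume "w \<in> Collect root_word"
    then have "root_word w" by simp
    then show "w \<in> ?g ` ?A \<union> ?h ` ?B" by cases force+
  next
    fix w assume "w \<in> ?g ` ?A \<union> ?h ` ?B"
    then show "w \<in> Collect root_word" using root_word_single root_word_append by auto
  qed
  have disj: "?g ` ?A \<inter> ?h ` ?B = {}"
  proof (rule ccontr)
    assume "?g ` ?A \<inter> ?h ` ?B \<noteq> {}"
    then obtain p q p' q' r a where h: "gap_word p" "gap_word q" "gap_word p'" "gap_word q'" "root_word a"
      "U # p @ U # q @ U # [] = U # p' @ U # q' @ U # r @ a" by auto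
    from block_unique[OF h(1-4,6)] have "a = []" by simp
    then show False using root_word_start[OF h(5)] by simp
  qed
  have inj: "inj_on ?h ?B"
  proof (rule inj_onI, clarsimp)
    fix p q r a p' q' r' a'
    assume h: "gap_word p" "gap_word q" "gap_word r" "root_word a" "gap_word p'" "gap_word q'" "gap_word r'" "root_word a'"
      "p @ U # q @ U # r @ a = p' @ U # q' @ U # r' @ a'"
    then have e: "p = p' \<and> q = q' \<and> r @ a = r' @ a'" by (intro block_unique) auto
    \<comment> \<open>The third gap is delimited by the first letter \<open>U\<close> of the rest of
      the root word.\<close>
    obtain b b' where b: "a = U # b" "a' = U # b'" using root_word_start h by blast
    then have "r = r'" using gap_word_prefix_unique[of r r' b b'] h e by simp
    then show "p = p' \<and> q = q' \<and> r = r' \<and> a = a'" using e by simp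
  qed
  have "weight_gf excess nodes (?h ` ?B) = weight_gf (excess \<circ> ?h) (nodes \<circ> ?h) ?B"
    by (rule weight_gf_image[OF inj])
  also have "\<dots> = weight_gf (\<lambda>x. (case x of (p, y) \<Rightarrow> excess p +
        (case y of (q, z) \<Rightarrow> excess q + (case z of (r, a) \<Rightarrow> excess r + excess a))) + 3)
      (\<lambda>x. (case x of (p, y) \<Rightarrow> nodes p +
        (case y of (q, z) \<Rightarrow> nodes q + (case z of (r, a) \<Rightarrow> nodes r + nodes a))) + 0) ?B"
    by (rule weight_gf_cong) (auto simp: balanced_words balanced_simps weights_simps)
  also have "\<dots> = Z ^ 3 * W ^ 0 * (word_gf gap_word * (word_gf gap_word * (word_gf gap_word * word_gf root_word)))"
    unfolding weight_gf_shift
    by (simp add: weight_gf_Times finite_weights_words finite_weights_Times)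
  finally have "weight_gf excess nodes (?h ` ?B) = Z ^ 3 * word_gf gap_word ^ 3 * word_gf root_word"
    by (simp add: power3_eq_cube mult.assoc)
  then show ?thesis
    using weight_gf_union[OF finite_weights_words finite_weights_words disj] weight_gf_block
    unfolding eq[symmetric] by simp
qed

text \<open>Enclosing a cell in two letters \<open>S\<close> adds one node and lowers the excess by
  2; the factor \<open>Z ^ 2\<close> stands on the left to avoid a negative power.\<close>

lemma gf_gap_word: "Z ^ 2 * (word_gf gap_word - 1) = W * word_gf cell_word"
proof -
  let ?g = "\<lambda>a. S # a @ [S]"
  have eq: "Collect gap_word = {[]} \<union> ?g ` Collect cell_word"
    using gap_word_start gap_word_Nil gap_word_wrap by blast
  have inj: "inj_on ?g (Collect cell_word)" by (auto intro: inj_onI)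
  have "weight_gf excess nodes (?g ` Collect cell_word) = weight_gf (excess \<circ> ?g) (nodes \<circ> ?g) (Collect cell_word)"
    by (rule weight_gf_image[OF inj])
  then have "Z ^ 2 * weight_gf excess nodes (?g ` Collect cell_word) =
      weight_gf (\<lambda>x. (excess \<circ> ?g) x + 2) (\<lambda>x. (nodes \<circ> ?g) x + 0) (Collect cell_word)"
    unfolding weight_gf_shift by (simp add: comp_def)
  also have "\<dots> = weight_gf (\<lambda>x. excess x + 0) (\<lambda>x. nodes x + 1) (Collect cell_word)"
    by (rule weight_gf_cong) (auto simp: excess_def nodes_def dest!: cell_word_counts elim!: evenE)
  also have "\<dots> = W * word_gf cell_word" unfolding weight_gf_shift by simp
  finally have A: "Z ^ 2 * weight_gf excess nodes (?g ` Collect cell_word) = W * word_gf cell_word" .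
  have one: "weight_gf excess nodes {[]} = 1"
  proof (intro fps_ext)
    fix n m
    have "{x \<in> {[]}. excess x = n \<and> nodes x = m} = (if n = 0 \<and> m = 0 then {[]} else {})"
      by (auto simp: excess_def nodes_def)
    then show "weight_gf excess nodes {[]} $ n $ m = 1 $ n $ m"
      by (simp add: weight_gf_def)
  qed
  have "word_gf gap_word = 1 + weight_gf excess nodes (?g ` Collect cell_word)"
    unfolding eq one[symmetric] by (rule weight_gf_union[OF finite_weights_words finite_weights_words]) auto
  then show ?thesis using A by simp
qed

text \<open>\<open>word_of\<close> is a bijection between the two sets: parsing gives one inclusion,
  filling gaps gives the other. The root cell accounts for the shift by one between cells and
  nodes.\<close>

lemma card_ear_quiddity_words:
  "card {a. ear_quiddity (Suc m) a \<and> length a = n + 2} = card {w \<in> Collect root_word. excess w = n + 2 \<and> nodes w = m}"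
proof -
  have weights: "excess (word_of a) = length a" "Suc (nodes (word_of a)) = k" if "ear_quiddity k a" for k a
    using ear_quiddity_props[OF that] count_word_of[of a] by (auto simp: excess_def nodes_def)
  have "{w \<in> Collect root_word. excess w = n + 2 \<and> nodes w = m} = word_of ` {a. ear_quiddity (Suc m) a \<and> length a = n + 2}"
  proof (intro set_eqI iffI)
    fix w assume w: "w \<in> {w \<in> Collect root_word. excess w = n + 2 \<and> nodes w = m}"
    then obtain k a where a: "ear_quiddity k a" "w = word_of a"
      using root_word_imp_ear_quiddity_word[of w] unfolding quiddity_word_def by blast
    then have "length a = n + 2" "k = Suc m" using weights[OF a(1)] w by auto
    then show "w \<in> word_of ` {a. ear_quiddity (Suc m) a \<and> length a = n + 2}" using a by auto
  next
    fix w assume "w \<in> word_of ` {a. ear_quiddity (Suc m) a \<and> length a = n + 2}"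
    then obtain a where "ear_quiddity (Suc m) a" "length a = n + 2" "w = word_of a" by blast
    then show "w \<in> {w \<in> Collect root_word. excess w = n + 2 \<and> nodes w = m}"
      using ear_quiddity_imp_root_word weights[of "Suc m" a] by simp
  qed
  moreover have "inj_on word_of {a. ear_quiddity (Suc m) a \<and> length a = n + 2}"
    using inj_word_of ear_quiddity_props by (auto intro!: inj_onI)
  ultimately show ?thesis by (simp add: card_image)
qed

text \<open>\<open>Z ^ 2\<close> absorbs the two vertices by which the polygon exceeds
  \<open>n\<close>, and \<open>W\<close> counts the root cell. The series 1 is the convention for
  \<open>n = 0\<close>; root words have excess at least 3 and contribute nothing there.\<close>

lemma gf_quiddity: "Z ^ 2 * (quiddity_gf - 1) = W * word_gf root_word"
proof (intro fps_ext)
  fix n m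
  have R0: "{w. root_word w \<and> excess w = n \<and> nodes w = m} = {}" if "n \<le> 2" for n m
    using that by (auto simp: excess_def dest!: root_word_counts)
  have nm: "quiddity_gf $ n $ m - (1 :: rat fps fps) $ n $ m =
      (if m = 0 then 0 else of_nat (card {w. root_word w \<and> excess w = n + 2 \<and> nodes w = m - 1}))" for n m
  proof (cases "n = 0")
    case True
    then have "{w. root_word w \<and> excess w = n + 2 \<and> nodes w = m - 1} = {}" by (intro R0) simp
    then show ?thesis using True by (simp only:) (simp add: quiddity_gf_def quiddity_count_def)
  next
    case False
    then have n: "n \<ge> 1" by simp
    have "quiddity_count n m = card {a. ear_quiddity m a \<and> length a = n + 2}"
      using False quiddities_eq[OF n] by (simp add: quiddity_count_def)
    also have "\<dots> = (if m = 0 then 0 else card {w. root_word w \<and> excess w = n + 2 \<and> nodes w = m - 1})"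
    proof (cases m)
      case 0
      then have empty: "{a. ear_quiddity m a \<and> length a = n + 2} = {}" using ear_quiddity_props by blast
      show ?thesis unfolding empty using 0 by simp
    next
      case (Suc l)
      then show ?thesis using card_ear_quiddity_words[of l n] by simp
    qed
    finally show ?thesis using False by (simp add: quiddity_gf_def)
  qed
  have "(Z ^ 2 * (quiddity_gf - 1)) $ n $ m =
      (if n < 2 then 0 else quiddity_gf $ (n - 2) $ m - (1 :: rat fps fps) $ (n - 2) $ m)"
    by (simp add: fps_X_power_mult_nth)
  moreover have "\<dots> = (if n < 2 \<or> m = 0 then 0 else of_nat (card {w. root_word w \<and> excess w = n \<and> nodes w = m - 1}))"
  proof (cases "n < 2")
    case False
    then have "n - 2 + 2 = n" by simp
    then show ?thesis using False unfolding nm by (simp only:) simp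
  qed simp
  moreover have empty: "card {w. root_word w \<and> excess w = n \<and> nodes w = m - 1} = 0" if "n < 2"
    using R0[of n "m - 1"] that by (metis card.empty less_imp_le)
  ultimately show "(Z ^ 2 * (quiddity_gf - 1)) $ n $ m = (W * word_gf root_word) $ n $ m"
    using empty by (simp add: weight_gf_def)
qed

section \<open>Solving the functional equations\<close>

lemma fps_divide_iff:
  fixes x y h :: "rat fps fps"
  assumes "h $ 0 = 1"
  shows "x / h = y \<longleftrightarrow> x = y * h"
proof -
  have "h $ 0 * inverse (h $ 0) = 1" using assms by simp
  from fps_right_inverse[OF this] have h: "h * inverse h = 1" by (simp add: fps_inverse_def)
  have x: "x / h = x * inverse h" using assms by (simp add: fps_divide_unit)
  show ?thesis
  proof
    assume "x / h = y"
    then have "y * h = x * (h * inverse h)" using x by (simp only: mult_ac)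
    then show "x = y * h" using h by simp
  next
    assume "x = y * h"
    then have "x / h = y * (h * inverse h)" using x by (simp only: mult.assoc)
    then show "x / h = y" using h by simp
  qed
qed

lemma eq_one_plus_divide_iff:
  fixes x q h :: "rat fps fps"
  assumes "h $ 0 = 1"
  shows "q = 1 + x / h \<longleftrightarrow> x = (q - 1) * h"
proof -
  have "q = 1 + y \<longleftrightarrow> y = q - 1" for y by auto
  then show ?thesis using fps_divide_iff[OF assms] by blast
qed

text \<open>The partial sums telescope to \<open>L - L * g ^ N\<close>, and \<open>g ^ N\<close> has
  no terms below degree \<open>N\<close>, so each coefficient is eventually constant.\<close>

lemma fps_geometric_sums:
  fixes c g :: "rat fps fps"
  assumes "g $ 0 = 0"
  shows "(\<lambda>k. c * g ^ k) sums (c / (1 - g))"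
  unfolding sums_def
proof (rule tendsto_fpsI)
  fix n
  define L where "L = c / (1 - g)"
  have g1: "(1 - g) $ 0 = 1" using assms by simp
  have L: "c = L * (1 - g)" using fps_divide_iff[OF g1] L_def by blast
  have S: "(\<Sum>k<N. c * g ^ k) = L - L * g ^ N" for N
  proof (induction N)
    case (Suc N)
    have "c * g ^ N = L * g ^ N - L * g ^ Suc N" unfolding L by (simp add: algebra_simps)
    then show ?case using Suc by simp
  qed simp
  have "(\<Sum>k<N. c * g ^ k) $ n = L $ n" if "N \<ge> Suc n" for N
  proof -
    have "(g ^ N) $ i = 0" if "i \<le> n" for i
      using startsby_zero_power_prefix[OF assms] that \<open>N \<ge> Suc n\<close> by auto
    then have "(L * g ^ N) $ n = 0" by (simp add: fps_mult_nth)
    then show ?thesis unfolding S by simp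
  qed
  then show "eventually (\<lambda>N. (\<Sum>k<N. c * g ^ k) $ n = (c / (1 - g)) $ n) sequentially"
    unfolding L_def[symmetric] by (rule eventually_sequentiallyI)
qed

lemma P_equation_iff:
  fixes P :: "rat fps fps"
  shows "P = 1 + W * Z * P^2 / (1 - Z^3 * P^2) \<longleftrightarrow> W * Z * P^2 = (P - 1) * (1 - Z^3 * P^2)"
  by (rule eq_one_plus_divide_iff) simp

lemma P_equation_unique:
  fixes P P' :: "rat fps fps"
  assumes "W * Z * P^2 = (P - 1) * (1 - Z^3 * P^2)" "W * Z * P'^2 = (P' - 1) * (1 - Z^3 * P'^2)"
  shows "P = P'"
proof -
  \<comment> \<open>\<open>F\<close> is the cofactor of \<open>P - P'\<close> in the difference of
    the two equations; its constant term 1 makes it nonzero in an integral domain.\<close>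
  define F where "F = 1 - Z * (W * (P + P') + Z^2 * (P^2 + P * P' + P'^2) - Z^2 * (P + P'))"
  have "(p - q) * (1 - z * (w * (p + q) + z^2 * (p^2 + p * q + q^2) - z^2 * (p + q)))
      = ((p - 1) * (1 - z^3 * p^2) - w * z * p^2) - ((q - 1) * (1 - z^3 * q^2) - w * z * q^2)"
    for p q w z :: "rat fps fps"
    by algebra
  then have "(P - P') * F = ((P - 1) * (1 - Z^3 * P^2) - W * Z * P^2) - ((P' - 1) * (1 - Z^3 * P'^2) - W * Z * P'^2)"
    unfolding F_def .
  then have "(P - P') * F = 0" using assms by simp
  moreover have "F $ 0 = 1" by (simp add: F_def)
  then have "F \<noteq> 0" by auto
  ultimately show ?thesis by simp
qed

text \<open>The equation for cell words is linear in their series and is solved for it; substitution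
  into \<open>gf_gap_word\<close> leaves a common factor \<open>Z^2\<close>, which cancels.\<close>

lemma word_gf_gap_word_equation:
  "W * Z * word_gf gap_word ^ 2 = (word_gf gap_word - 1) * (1 - Z^3 * word_gf gap_word ^ 2)"
proof -
  let ?P = "word_gf gap_word"
  have "Z^2 * ((?P - 1) * (1 - Z^3 * ?P^2)) = W * (word_gf cell_word * (1 - Z^3 * ?P^2))"
    using gf_gap_word by (simp flip: mult.assoc)
  also have "word_gf cell_word * (1 - Z^3 * ?P^2) = Z^3 * ?P^2"
    using gf_cell_word by (simp add: algebra_simps)
  also have "W * (Z^3 * ?P^2) = Z^2 * (W * Z * ?P^2)"
    by (simp add: power2_eq_square power3_eq_cube mult_ac)
  finally show ?thesis by simp
qed

lemma quiddity_gf_equation: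
  "W * Z * word_gf gap_word ^ 2 = (quiddity_gf - 1) * (1 - Z^3 * word_gf gap_word ^ 3)"
proof -
  let ?P = "word_gf gap_word"
  have "Z^2 * ((quiddity_gf - 1) * (1 - Z^3 * ?P^3)) = W * (word_gf root_word * (1 - Z^3 * ?P^3))"
    using gf_quiddity by (simp flip: mult.assoc)
  also have "word_gf root_word * (1 - Z^3 * ?P^3) = Z^3 * ?P^2"
    using gf_root_word by (simp add: algebra_simps)
  also have "W * (Z^3 * ?P^2) = Z^2 * (W * Z * ?P^2)"
    by (simp add: power2_eq_square power3_eq_cube mult_ac)
  finally show ?thesis by simp
qed

theorem theorem2p10:
  shows "(\<exists>!P :: rat fps fps. P = 1 + W * Z * P^2 / (1 - Z^3 * P^2)) \<and>
    (\<forall>P :: rat fps fps.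
       P = 1 + W * Z * P^2 / (1 - Z^3 * P^2) \<longleftrightarrow>
       (\<lambda>k. W * Z^(3*k+1) * P^(2*k+2)) sums (P - 1)) \<and>
    (\<forall>P :: rat fps fps.
       P = 1 + W * Z * P^2 / (1 - Z^3 * P^2) \<longrightarrow>
       (\<lambda>k. W * Z^(3*k+1) * P^(3*k+2)) sums (quiddity_gf - 1) \<and>
       quiddity_gf = 1 + W * Z * P^2 / (1 - Z^3 * P^3))"
proof (intro conjI allI impI)
  show "\<exists>!P :: rat fps fps. P = 1 + W * Z * P^2 / (1 - Z^3 * P^2)"
    unfolding P_equation_iff using word_gf_gap_word_equation P_equation_unique by blast
next
  fix P :: "rat fps fps"
  have "(\<lambda>k. W * Z^(3*k+1) * P^(2*k+2)) = (\<lambda>k. W * Z * P^2 * (Z^3 * P^2) ^ k)"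
    by (simp only: power_mult_distrib power_add power_mult power_one_right) (simp add: mult_ac)
  then have L: "(\<lambda>k. W * Z^(3*k+1) * P^(2*k+2)) sums (W * Z * P^2 / (1 - Z^3 * P^2))"
    using fps_geometric_sums[of "Z^3 * P^2" "W * Z * P^2"] by simp
  show "P = 1 + W * Z * P^2 / (1 - Z^3 * P^2) \<longleftrightarrow>
      (\<lambda>k. W * Z^(3*k+1) * P^(2*k+2)) sums (P - 1)"
  proof
    assume "P = 1 + W * Z * P^2 / (1 - Z^3 * P^2)"
    then have "P - 1 = W * Z * P^2 / (1 - Z^3 * P^2)" by (metis add_diff_cancel_left')
    then show "(\<lambda>k. W * Z^(3*k+1) * P^(2*k+2)) sums (P - 1)" using L by (simp only:)
  next
    assume "(\<lambda>k. W * Z^(3*k+1) * P^(2*k+2)) sums (P - 1)"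
    from sums_unique2[OF this L] show "P = 1 + W * Z * P^2 / (1 - Z^3 * P^2)"
      by (metis add_diff_cancel_left' add.commute diff_add_cancel)
  qed
next
  fix P :: "rat fps fps"
  assume "P = 1 + W * Z * P^2 / (1 - Z^3 * P^2)"
  \<comment> \<open>By uniqueness, \<open>P\<close> counts gap words, so the equation for root words
    applies to it.\<close>
  then have P: "P = word_gf gap_word"
    unfolding P_equation_iff using word_gf_gap_word_equation P_equation_unique by blast
  have "(1 - Z^3 * P^3) $ 0 = 1" by simp
  then show Q: "quiddity_gf = 1 + W * Z * P^2 / (1 - Z^3 * P^3)"
    using eq_one_plus_divide_iff[of "1 - Z^3 * P^3" quiddity_gf "W * Z * P^2"] quiddity_gf_equation
    unfolding P by simp
  have "(\<lambda>k. W * Z^(3*k+1) * P^(3*k+2)) = (\<lambda>k. W * Z * P^2 * (Z^3 * P^3) ^ k)"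
    by (simp only: power_mult_distrib power_add power_mult power_one_right) (simp add: mult_ac)
  moreover have "quiddity_gf - 1 = W * Z * P^2 / (1 - Z^3 * P^3)" unfolding Q by simp
  ultimately show "(\<lambda>k. W * Z^(3*k+1) * P^(3*k+2)) sums (quiddity_gf - 1)"
    using fps_geometric_sums[of "Z^3 * P^3" "W * Z * P^2"] by (simp only:) simp
qed

end
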